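(* Let $\nu$ be a lattice path from $(0,0)$ to $(b,a)$. The poset of $\nu$-Schröder trees is isomorphic to the poset of $\nu$-Schröder paths.
   Context: A lattice path from $(0,0)$ to $(b,a)\in\mathbb{Z}_{\ge0}^2$ is a sequence of $a$ north steps $N=(0,1)$ and $b$ east steps $E=(1,0)$. A $\nu$-Schröder path is a path from $(0,0)$ to $(b,a)$ with steps $N$, $E$, $D=(1,1)$ which stays weakly above $\nu$. Trees. $R_\nu$ is the region weakly above $\nu$ inside the rectangle defined by $(0,0)$ and $(b,a)$. Two lattice points $p,q$ in $R_\nu$ are $\nu$-incompatible if and only if $p$ is (strictly) southwest or northeast of $q$ and the smallest rectangle containing $p$ and $q$ is contained in $R_\nu$; otherwise they are $\nu$-compatible. A $\nu$-Schröder tree is a set of pairwise $\nu$-compatible lattice points in $R_\nu$ which includes the point $(0,a)$ (the root), such that each row and each column contains at least one point of the set. It is viewed as a plane tree as follows: the parent of a non-root point $p$ is the nearest point of the set above $p$ in its column, or the nearest point of the set to the left of $p$ in its row, if one of these exists (both cannot exist); otherwise it is the point $q$ of the set, northwest of $p$, such that the box with opposite corners $p$ and $q$ is the smallest rectangular box containing $p$ and exactly one other point of the set. A leaf is a point that is not the parent of any point. Contractions of a $\nu$-Schröder tree $S$ are the following. - Right contraction: if $p,q,r\in S$ are such that $p$ is the first point of $S$ above $q$ and $r$ is the first point of $S$ to the right of $q$, remove $q$. - Left contraction: if $p,q,r\in S$ are such that $p$ is the first point of $S$ to the left of $q$ and $r$ is the first point of $S$ below $q$, remove $q$. - Diagonal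 contraction: if $r\in S$ is southeast of a non-leaf point $p\in S$, with neither of the other two corners of the box determined by $p$ and $r$ containing a point of $S$, and if removing $r$ yields a $\nu$-Schröder tree, remove $r$. The poset of $\nu$-Schröder trees is the set of $\nu$-Schröder trees with the partial order induced by the cover relation $T\prec T'$ if and only if $T'$ is a contraction of $T$. Paths. For a lattice point $p$ of a $\nu$-Schröder path, $\mathrm{horiz}_\nu(p)$ is the maximal number of east steps that can be placed starting at $p$ before crossing $\nu$ (while remaining in the smallest rectangle containing $\nu$). The (contraction) poset of $\nu$-Schröder paths is the set of $\nu$-Schröder paths with cover relation $\mu\prec\lambda$ if and only if $\lambda$ is formed from $\mu$ by a contraction, the contraction moves being the following. 1. Right contraction: replace a consecutive $EN$ pair with $D$. 2. Left contraction: delete an $E$ step with initial point $q$, along with the preceding $N$ step with initial point $r$ satisfying $\mathrm{horiz}_\nu(r)=\mathrm{horiz}_\nu(q)$. Shift the subpath between the deleted steps one unit to the right, and place a $D$ step at $r$. 3. Diagonal contraction: delete an $E$ step ending at a point $r$, which is the initial point of a $D$ step, along with the preceding $N$ step with initial point $s$ satisfying $\mathrm{horiz}_\nu(s)=\mathrm{horiz}_\nu(r)$. Shift the subpath between the deleted steps one unit to the right, and place a $D$ step at $s$.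
   Formalization: In the left and diagonal path contractions, the deleted N step must start at the last lattice point before q (resp. r) with the same horizontal distance; taking just the nearest preceding N step with equal horiz makes the claim false, e.g. for ν = EENNE. *)

theory Defs
  imports "HOL-Analysis.Analysis"
begin

section \<open>Lattice paths and the region above a path\<close>

datatype step = North | East | Diag

fun move :: "nat \<times> nat \<Rightarrow> step \<Rightarrow> nat \<times> nat" where
  "move (x, y) North = (x, y + 1)"
| "move (x, y) East = (x + 1, y)"
| "move (x, y) Diag = (x + 1, y + 1)"

definition endpoint :: "step list \<Rightarrow> nat \<times> nat" where
  "endpoint w = foldl move (0, 0) w"

text \<open>The lattice point reached after the first \<open>i\<close> steps.\<close>

definition vertex :: "step list \<Rightarrow> nat \<Rightarrow> nat \<times> nat" where
  "vertex w i = endpoint (take i w)"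

definition lattice_path :: "nat \<Rightarrow> nat \<Rightarrow> step list \<Rightarrow> bool" where
  "lattice_path a b w \<longleftrightarrow> set w \<subseteq> {North, East} \<and> endpoint w = (b, a)"

definition real_pt :: "nat \<times> nat \<Rightarrow> real \<times> real" where
  "real_pt p = (real (fst p), real (snd p))"

text \<open>The subset of the plane traced out by a path; the explicit origin matters only
  for the empty path.\<close>

definition curve :: "step list \<Rightarrow> (real \<times> real) set" where
  "curve w = insert (0, 0)
     (\<Union>i<length w. closed_segment (real_pt (vertex w i)) (real_pt (vertex w (Suc i))))"

text \<open>The part of the rectangle \<open>[0, b] \<times> [0, a]\<close> weakly above \<open>\<nu>\<close>, where \<open>(b, a)\<close> is the
  end of \<open>\<nu>\<close>. It is a region of the plane, not just a set of lattice points: a diagonal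
  step can have both ends on \<open>\<nu>\<close> and nevertheless run below \<open>\<nu>\<close>.\<close>

definition region :: "step list \<Rightarrow> (real \<times> real) set" where
  "region \<nu> = {(x, y). 0 \<le> x \<and> x \<le> real (fst (endpoint \<nu>)) \<and>
                       0 \<le> y \<and> y \<le> real (snd (endpoint \<nu>)) \<and>
                       (\<exists>y' \<le> y. (x, y') \<in> curve \<nu>)}"

definition schroeder_path :: "step list \<Rightarrow> step list \<Rightarrow> bool" where
  "schroeder_path \<nu> w \<longleftrightarrow> endpoint w = endpoint \<nu> \<and> curve w \<subseteq> region \<nu>"

section \<open>Schroeder trees\<close>

definition rect :: "nat \<times> nat \<Rightarrow> nat \<times> nat \<Rightarrow> (real \<times> real) set" where
  "rect p q = {real (min (fst p) (fst q)) .. real (max (fst p) (fst q))} \<times>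
              {real (min (snd p) (snd q)) .. real (max (snd p) (snd q))}"

definition southwest :: "nat \<times> nat \<Rightarrow> nat \<times> nat \<Rightarrow> bool" where
  "southwest p q \<longleftrightarrow> fst p < fst q \<and> snd p < snd q"

definition northwest :: "nat \<times> nat \<Rightarrow> nat \<times> nat \<Rightarrow> bool" where
  "northwest p q \<longleftrightarrow> fst p < fst q \<and> snd q < snd p"

definition incompatible :: "step list \<Rightarrow> nat \<times> nat \<Rightarrow> nat \<times> nat \<Rightarrow> bool" where
  "incompatible \<nu> p q \<longleftrightarrow> (southwest p q \<or> southwest q p) \<and> rect p q \<subseteq> region \<nu>"

definition tree_root :: "step list \<Rightarrow> nat \<times> nat" where
  "tree_root \<nu> = (0, snd (endpoint \<nu>))"

definition schroeder_tree :: "step list \<Rightarrow> (nat \<times> nat) set \<Rightarrow> bool" where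
  "schroeder_tree \<nu> T \<longleftrightarrow>
     (\<forall>p\<in>T. real_pt p \<in> region \<nu>) \<and>
     (\<forall>p\<in>T. \<forall>q\<in>T. \<not> incompatible \<nu> p q) \<and>
     tree_root \<nu> \<in> T \<and>
     (\<forall>y \<le> snd (endpoint \<nu>). \<exists>x. (x, y) \<in> T) \<and>
     (\<forall>x \<le> fst (endpoint \<nu>). \<exists>y. (x, y) \<in> T)"

text \<open>\<open>first_above T q p\<close>: the first point of \<open>T\<close> above \<open>q\<close> in its column is \<open>p\<close>;
  similarly in the other three directions.\<close>

definition first_above :: "(nat \<times> nat) set \<Rightarrow> nat \<times> nat \<Rightarrow> nat \<times> nat \<Rightarrow> bool" where
  "first_above T q p \<longleftrightarrow> p \<in> T \<and> fst p = fst q \<and> snd q < snd p \<and>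
     (\<forall>s\<in>T. fst s = fst q \<and> snd q < snd s \<longrightarrow> snd p \<le> snd s)"

definition first_below :: "(nat \<times> nat) set \<Rightarrow> nat \<times> nat \<Rightarrow> nat \<times> nat \<Rightarrow> bool" where
  "first_below T q p \<longleftrightarrow> p \<in> T \<and> fst p = fst q \<and> snd p < snd q \<and>
     (\<forall>s\<in>T. fst s = fst q \<and> snd s < snd q \<longrightarrow> snd s \<le> snd p)"

definition first_left :: "(nat \<times> nat) set \<Rightarrow> nat \<times> nat \<Rightarrow> nat \<times> nat \<Rightarrow> bool" where
  "first_left T q p \<longleftrightarrow> p \<in> T \<and> snd p = snd q \<and> fst p < fst q \<and>
     (\<forall>s\<in>T. snd s = snd q \<and> fst s < fst q \<longrightarrow> fst s \<le> fst p)"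

definition first_right :: "(nat \<times> nat) set \<Rightarrow> nat \<times> nat \<Rightarrow> nat \<times> nat \<Rightarrow> bool" where
  "first_right T q p \<longleftrightarrow> p \<in> T \<and> snd p = snd q \<and> fst q < fst p \<and>
     (\<forall>s\<in>T. snd s = snd q \<and> fst q < fst s \<longrightarrow> fst p \<le> fst s)"

definition isolating_box :: "(nat \<times> nat) set \<Rightarrow> nat \<times> nat \<Rightarrow> nat \<times> nat \<Rightarrow> bool" where
  "isolating_box T p q \<longleftrightarrow> q \<in> T \<and> northwest q p \<and> {s \<in> T. real_pt s \<in> rect p q} = {p, q}"

text \<open>\<open>parent \<nu> T p q\<close>: the parent of \<open>p\<close> is \<open>q\<close>.\<close>

definition parent :: "step list \<Rightarrow> (nat \<times> nat) set \<Rightarrow> nat \<times> nat \<Rightarrow> nat \<times> nat \<Rightarrow> bool" where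
  "parent \<nu> T p q \<longleftrightarrow> p \<in> T \<and> p \<noteq> tree_root \<nu> \<and>
     (first_above T p q \<or> first_left T p q \<or>
      (\<nexists>s. first_above T p s \<or> first_left T p s) \<and>
      isolating_box T p q \<and> (\<forall>q'. isolating_box T p q' \<longrightarrow> rect p q \<subseteq> rect p q'))"

definition leaf :: "step list \<Rightarrow> (nat \<times> nat) set \<Rightarrow> nat \<times> nat \<Rightarrow> bool" where
  "leaf \<nu> T q \<longleftrightarrow> q \<in> T \<and> (\<nexists>p. parent \<nu> T p q)"

definition tree_right_contraction :: "(nat \<times> nat) set \<Rightarrow> (nat \<times> nat) set \<Rightarrow> bool" where
  "tree_right_contraction T T' \<longleftrightarrow>
     (\<exists>p q r. q \<in> T \<and> first_above T q p \<and> first_right T q r \<and> T' = T - {q})"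

definition tree_left_contraction :: "(nat \<times> nat) set \<Rightarrow> (nat \<times> nat) set \<Rightarrow> bool" where
  "tree_left_contraction T T' \<longleftrightarrow>
     (\<exists>p q r. q \<in> T \<and> first_left T q p \<and> first_below T q r \<and> T' = T - {q})"

definition tree_diagonal_contraction ::
    "step list \<Rightarrow> (nat \<times> nat) set \<Rightarrow> (nat \<times> nat) set \<Rightarrow> bool" where
  "tree_diagonal_contraction \<nu> T T' \<longleftrightarrow>
     (\<exists>p r. p \<in> T \<and> r \<in> T \<and> northwest p r \<and> \<not> leaf \<nu> T p \<and>
            (fst p, snd r) \<notin> T \<and> (fst r, snd p) \<notin> T \<and>
            schroeder_tree \<nu> (T - {r}) \<and> T' = T - {r})"

definition tree_cover :: "step list \<Rightarrow> (nat \<times> nat) set rel" where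
  "tree_cover \<nu> = {(T, T'). schroeder_tree \<nu> T \<and> schroeder_tree \<nu> T' \<and>
     (tree_right_contraction T T' \<or> tree_left_contraction T T' \<or>
      tree_diagonal_contraction \<nu> T T')}"

definition schroeder_trees :: "step list \<Rightarrow> (nat \<times> nat) set set" where
  "schroeder_trees \<nu> = {T. schroeder_tree \<nu> T}"

definition tree_order :: "step list \<Rightarrow> (nat \<times> nat) set rel" where
  "tree_order \<nu> = (tree_cover \<nu>)\<^sup>* \<inter> schroeder_trees \<nu> \<times> schroeder_trees \<nu>"

section \<open>Contractions of Schroeder paths\<close>

definition horiz :: "step list \<Rightarrow> nat \<times> nat \<Rightarrow> nat" where
  "horiz \<nu> p = Max {k. closed_segment (real_pt p) (real_pt (fst p + k, snd p)) \<subseteq> region \<nu>}"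

text \<open>The \<open>i\<close>-th vertex of \<open>w\<close> is the last one before the \<open>j\<close>-th vertex with the same
  horizontal distance as the \<open>j\<close>-th. In the left and diagonal contractions this is what
  singles out the preceding north step to be deleted. Merely asking for a north step whose
  initial vertex has the right horizontal distance would not do: there can be several, and
  shifting the subpath after a wrong one may push it below \<open>\<nu>\<close>. For instance, for
  \<open>\<nu> = ENNE\<close> the last east step of \<open>NENE\<close> would be paired with the first north step, giving
  the path \<open>DEN\<close>, which crosses \<open>\<nu>\<close>.\<close>

definition last_same_horiz :: "step list \<Rightarrow> step list \<Rightarrow> nat \<Rightarrow> nat \<Rightarrow> bool" where
  "last_same_horiz \<nu> w i j \<longleftrightarrow> i < j \<and> horiz \<nu> (vertex w i) = horiz \<nu> (vertex w j) \<and>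
     (\<forall>k. i < k \<and> k < j \<longrightarrow> horiz \<nu> (vertex w k) \<noteq> horiz \<nu> (vertex w j))"

definition path_right_contraction :: "step list \<Rightarrow> step list \<Rightarrow> bool" where
  "path_right_contraction w w' \<longleftrightarrow>
     (\<exists>u v. w = u @ [East, North] @ v \<and> w' = u @ [Diag] @ v)"

definition path_left_contraction :: "step list \<Rightarrow> step list \<Rightarrow> step list \<Rightarrow> bool" where
  "path_left_contraction \<nu> w w' \<longleftrightarrow>
     (\<exists>u v t. w = u @ [North] @ v @ [East] @ t \<and> w' = u @ [Diag] @ v @ t \<and>
        last_same_horiz \<nu> w (length u) (length (u @ [North] @ v)))"

definition path_diagonal_contraction :: "step list \<Rightarrow> step list \<Rightarrow> step list \<Rightarrow> bool" where
  "path_diagonal_contraction \<nu> w w' \<longleftrightarrow>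
     (\<exists>u v t. w = u @ [North] @ v @ [East, Diag] @ t \<and> w' = u @ [Diag] @ v @ [Diag] @ t \<and>
        last_same_horiz \<nu> w (length u) (length (u @ [North] @ v @ [East])))"

definition path_cover :: "step list \<Rightarrow> step list rel" where
  "path_cover \<nu> = {(w, w'). schroeder_path \<nu> w \<and> schroeder_path \<nu> w' \<and>
     (path_right_contraction w w' \<or> path_left_contraction \<nu> w w' \<or>
      path_diagonal_contraction \<nu> w w')}"

definition schroeder_paths :: "step list \<Rightarrow> step list set" where
  "schroeder_paths \<nu> = {w. schroeder_path \<nu> w}"

definition path_order :: "step list \<Rightarrow> step list rel" where
  "path_order \<nu> = (path_cover \<nu>)\<^sup>* \<inter> schroeder_paths \<nu> \<times> schroeder_paths \<nu>"

section \<open>Both relations are partial orders\<close>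

lemma partial_order_on_closure:
  fixes f :: "'a \<Rightarrow> nat"
  assumes dec: "\<And>x y. (x, y) \<in> r \<Longrightarrow> f y < f x"
  shows "partial_order_on A (r\<^sup>* \<inter> A \<times> A)"
proof -
  have mono: "f y \<le> f x \<and> (x = y \<or> f y < f x)" if "(x, y) \<in> r\<^sup>*" for x y
    using that by (induction rule: rtrancl_induct) (auto dest: dec)
  have "antisym (r\<^sup>* \<inter> A \<times> A)"
  proof (rule antisymI)
    fix x y assume "(x, y) \<in> r\<^sup>* \<inter> A \<times> A" "(y, x) \<in> r\<^sup>* \<inter> A \<times> A"
    then show "x = y"
      using mono[of x y] mono[of y x] by auto
  qed
  moreover have "trans (r\<^sup>* \<inter> A \<times> A)"
    by (rule transI) (auto intro: rtrancl_trans)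
  ultimately show ?thesis
    by (auto simp: partial_order_on_def preorder_on_def refl_on_def)
qed

lemma finite_schroeder_tree:
  assumes "schroeder_tree \<nu> T"
  shows "finite T"
proof (rule finite_subset)
  show "T \<subseteq> {..fst (endpoint \<nu>)} \<times> {..snd (endpoint \<nu>)}"
    using assms by (auto simp: schroeder_tree_def region_def real_pt_def)
qed simp

lemma partial_order_tree_order: "partial_order_on (schroeder_trees \<nu>) (tree_order \<nu>)"
  unfolding tree_order_def
proof (rule partial_order_on_closure)
  fix T T' assume "(T, T') \<in> tree_cover \<nu>"
  then have "finite T" "\<exists>q\<in>T. T' = T - {q}"
    by (auto simp: tree_cover_def finite_schroeder_tree tree_right_contraction_def
        tree_left_contraction_def tree_diagonal_contraction_def)
  then show "card T' < card T"
    by (auto intro: card_Diff1_less)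
qed

lemma partial_order_path_order: "partial_order_on (schroeder_paths \<nu>) (path_order \<nu>)"
  unfolding path_order_def
proof (rule partial_order_on_closure)
  fix w w' assume "(w, w') \<in> path_cover \<nu>"
  then show "length w' < length w"
    by (auto simp: path_cover_def path_right_contraction_def path_left_contraction_def
        path_diagonal_contraction_def)
qed

end

theory Submission
  imports Defs
begin

text \<open>Read the nodes of a tree \<open>T\<close> row by row from the bottom, each row from right to left. A node
  with a left neighbour contributes an east step, a node below another one a north step, and a
  node whose parent lies strictly northwest a diagonal step; the root contributes nothing. This is
  a path whose \<open>i\<close>-th vertex corresponds to the \<open>i\<close>-th node: its height is the row of the node,
  and its abscissa is the number of columns whose topmost node has already been read. Compatibility
  of the nodes says exactly that every node lies in the last column available to it, that is, not
  yet left by its topmost node. Hence the tree can be rebuilt from the path.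

  The horizontal distance of a vertex is the number of available columns to the left of its node.
  Therefore, after a north step, the first vertex with the same horizontal distance belongs to the
  next node above in the same column. On the side of trees, the covers are the removals of one node
  that leave a tree; on the side of paths, they change the steps of that node, of its right
  neighbour and of its lower neighbour as the contractions of paths prescribe.\<close>

section \<open>The region above the path\<close>

lemma vertex_0 [simp]: "vertex w 0 = (0, 0)"
  by (simp add: vertex_def endpoint_def)

lemma vertex_Suc: "i < length w \<Longrightarrow> vertex w (Suc i) = move (vertex w i) (w ! i)"
  by (simp add: vertex_def endpoint_def take_Suc_conv_app_nth)

lemma vertex_length: "vertex w (length w) = endpoint w"
  by (simp add: vertex_def)

lemma fst_move: "fst (move p s) = (if s = North then fst p else Suc (fst p))"
  by (cases p; cases s) auto

lemma snd_move: "snd (move p s) = (if s = East then snd p else Suc (snd p))"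
  by (cases p; cases s) auto

lemma vertex_mono:
  assumes "i \<le> j" "j \<le> length w"
  shows "fst (vertex w i) \<le> fst (vertex w j) \<and> snd (vertex w i) \<le> snd (vertex w j)"
  using assms
proof (induction j rule: dec_induct)
  case (step n)
  then show ?case
    by (auto simp: vertex_Suc fst_move snd_move)
qed simp

text \<open>The sums are written \<open>1 + x\<close> since \<open>real (Suc n)\<close> simplifies
  to this form.\<close>

lemma closed_segment_horizontal_vertical:
  fixes x y :: real
  shows "(u, v) \<in> closed_segment (x, y) (1 + x, y) \<longleftrightarrow> x \<le> u \<and> u \<le> x + 1 \<and> v = y"
    and "(u, v) \<in> closed_segment (x, y) (x, 1 + y) \<longleftrightarrow> u = x \<and> y \<le> v \<and> v \<le> y + 1"
proof -
  show "(u, v) \<in> closed_segment (x, y) (1 + x, y) \<longleftrightarrow> x \<le> u \<and> u \<le> x + 1 \<and> v = y"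
    unfolding in_segment
    by (auto simp: algebra_simps intro!: exI[of _ "u - x"])
  show "(u, v) \<in> closed_segment (x, y) (x, 1 + y) \<longleftrightarrow> u = x \<and> y \<le> v \<and> v \<le> y + 1"
    unfolding in_segment
    by (auto simp: algebra_simps intro!: exI[of _ "v - y"])
qed

section \<open>Right ends of the rows of the region\<close>

text \<open>For \<open>y\<close> up to the height of \<nu>, this is the right end of row
  \<open>y\<close> of the region. Admitting all vertices of height at most \<open>y\<close>, not
  just those of height \<open>y\<close>, makes monotonicity in \<open>y\<close> immediate and gives
  a value above the top row too.\<close>

definition row_end :: "step list \<Rightarrow> nat \<Rightarrow> nat" where
  "row_end \<nu> y = Max (fst ` vertex \<nu> ` {i. i \<le> length \<nu> \<and> snd (vertex \<nu> i) \<le> y})"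

lemma row_end_ge: "i \<le> length \<nu> \<Longrightarrow> snd (vertex \<nu> i) \<le> y \<Longrightarrow> fst (vertex \<nu> i) \<le> row_end \<nu> y"
  unfolding row_end_def by (rule Max_ge) auto

lemma row_end_obtains:
  obtains i where "i \<le> length \<nu>" "snd (vertex \<nu> i) \<le> y" "fst (vertex \<nu> i) = row_end \<nu> y"
proof -
  have "row_end \<nu> y \<in> fst ` vertex \<nu> ` {i. i \<le> length \<nu> \<and> snd (vertex \<nu> i) \<le> y}"
    unfolding row_end_def by (rule Max_in) (auto intro!: exI[of _ 0])
  then show thesis
    using that by auto
qed

lemma row_end_mono: "y \<le> y' \<Longrightarrow> row_end \<nu> y \<le> row_end \<nu> y'"
  by (metis row_end_obtains row_end_ge le_trans)

locale nu_path =
  fixes a b :: nat and \<nu> :: "step list"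
  assumes lattice_path: "lattice_path a b \<nu>"
begin

abbreviation "\<rho> \<equiv> row_end \<nu>"

lemma endpoint_nu: "endpoint \<nu> = (b, a)"
  using lattice_path by (simp add: lattice_path_def)

lemma rho_top: "a \<le> y \<Longrightarrow> \<rho> y = b"
proof (rule antisym)
  show "\<rho> y \<le> b" for y
    using vertex_mono[of _ "length \<nu>" \<nu>] endpoint_nu
    by (metis row_end_obtains vertex_length fst_conv le_refl)
  show "b \<le> \<rho> y" if "a \<le> y"
    using row_end_ge[of "length \<nu>" \<nu> y] that by (simp add: vertex_length endpoint_nu)
qed

lemma rho_le: "\<rho> y \<le> b"
  using row_end_mono[of y "max a y" \<nu>] rho_top[of "max a y"] by simp

lemma step_nu: "i < length \<nu> \<Longrightarrow> \<nu> ! i = North \<or> \<nu> ! i = East"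
  using lattice_path nth_mem[of i \<nu>] unfolding lattice_path_def by blast

lemma curve_nu:
  fixes u v :: real
  shows "(u, v) \<in> curve \<nu> \<longleftrightarrow> (u, v) = (0, 0) \<or>
     (\<exists>i<length \<nu>. if \<nu> ! i = North
        then u = fst (vertex \<nu> i) \<and> snd (vertex \<nu> i) \<le> v \<and> v \<le> snd (vertex \<nu> i) + 1
        else fst (vertex \<nu> i) \<le> u \<and> u \<le> fst (vertex \<nu> i) + 1 \<and> v = snd (vertex \<nu> i))"
proof -
  have "(u, v) \<in> closed_segment (real_pt (vertex \<nu> i)) (real_pt (vertex \<nu> (Suc i))) \<longleftrightarrow>
      (if \<nu> ! i = North
        then u = fst (vertex \<nu> i) \<and> snd (vertex \<nu> i) \<le> v \<and> v \<le> snd (vertex \<nu> i) + 1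
        else fst (vertex \<nu> i) \<le> u \<and> u \<le> fst (vertex \<nu> i) + 1 \<and> v = snd (vertex \<nu> i))"
    if "i < length \<nu>" for i
    using step_nu[OF that]
    by (auto simp: vertex_Suc[OF that] real_pt_def fst_move snd_move closed_segment_horizontal_vertical)
  then show ?thesis
    unfolding curve_def by auto
qed

text \<open>Between consecutive integer heights \<nu> runs vertically, so the width of the region
  changes only at integer heights. From here on the geometry of the plane becomes arithmetic of row
  ends.\<close>

lemma region_nu:
  fixes x y :: real
  shows "(x, y) \<in> region \<nu> \<longleftrightarrow> 0 \<le> x \<and> 0 \<le> y \<and> y \<le> a \<and> x \<le> \<rho> (nat \<lfloor>y\<rfloor>)"
proof safe
  assume "(x, y) \<in> region \<nu>"
  then obtain v where "v \<le> y" "(x, v) \<in> curve \<nu>" and *: "0 \<le> x" "0 \<le> y" "y \<le> a"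
    by (auto simp: region_def endpoint_nu)
  then show "0 \<le> x" "0 \<le> y" "y \<le> a" by auto
  from \<open>(x, v) \<in> curve \<nu>\<close> consider "x = 0" | i where "i < length \<nu>" "\<nu> ! i = North"
      "x = fst (vertex \<nu> i)" "snd (vertex \<nu> i) \<le> v"
    | i where "i < length \<nu>" "\<nu> ! i \<noteq> North" "x \<le> fst (vertex \<nu> i) + 1" "v = snd (vertex \<nu> i)"
    by (auto simp: curve_nu split: if_splits)
  then show "x \<le> \<rho> (nat \<lfloor>y\<rfloor>)"
  proof cases
    case 2
    then have "snd (vertex \<nu> i) \<le> nat \<lfloor>y\<rfloor>"
      using \<open>v \<le> y\<close> by linarith
    then show ?thesis
      using row_end_ge[of i \<nu>] 2 by simp
  next
    case 3
    then have "snd (vertex \<nu> (Suc i)) \<le> nat \<lfloor>y\<rfloor>"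
      using \<open>v \<le> y\<close> step_nu[of i] by (simp add: vertex_Suc snd_move) linarith
    then have "fst (vertex \<nu> (Suc i)) \<le> \<rho> (nat \<lfloor>y\<rfloor>)"
      using 3 by (intro row_end_ge) auto
    then show ?thesis
      using 3 by (simp add: vertex_Suc fst_move)
  qed simp
next
  assume *: "0 \<le> x" "0 \<le> y" "y \<le> a" "x \<le> \<rho> (nat \<lfloor>y\<rfloor>)"
  obtain j where j: "j \<le> length \<nu>" "snd (vertex \<nu> j) \<le> nat \<lfloor>y\<rfloor>" "fst (vertex \<nu> j) = \<rho> (nat \<lfloor>y\<rfloor>)"
    by (rule row_end_obtains)
  \<comment> \<open>A discrete intermediate value argument: the abscissa \<open>x\<close> is reached
    at the origin or on some east step before vertex \<open>j\<close>, hence at a height not above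
    that vertex.\<close>
  have "\<exists>v. (x, v) \<in> curve \<nu> \<and> v \<le> snd (vertex \<nu> j)"
    if "j \<le> length \<nu>" "x \<le> fst (vertex \<nu> j)" for j
    using that
  proof (induction j)
    case 0
    then show ?case using * by (auto simp: curve_nu)
  next
    case (Suc j)
    show ?case
    proof (cases "x \<le> fst (vertex \<nu> j)")
      case True
      then show ?thesis
        using Suc vertex_mono[of j "Suc j" \<nu>] by force
    next
      case False
      then have "\<nu> ! j = East" using Suc.prems step_nu[of j] by (auto simp: vertex_Suc fst_move)
      then have "(x, real (snd (vertex \<nu> j))) \<in> curve \<nu>"
        using False Suc.prems by (auto simp: vertex_Suc fst_move curve_nu intro!: exI[of _ j])
      then show ?thesis
        using vertex_mono[of j "Suc j" \<nu>] Suc.prems by force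
    qed
  qed
  then obtain v where "(x, v) \<in> curve \<nu>" "v \<le> snd (vertex \<nu> j)"
    using j * by force
  moreover have "real (snd (vertex \<nu> j)) \<le> y"
    using j * by linarith
  ultimately show "(x, y) \<in> region \<nu>"
    using * rho_le[of "nat \<lfloor>y\<rfloor>"] by (auto simp: region_def endpoint_nu intro!: exI[of _ v])
qed

lemma real_pt_region: "real_pt p \<in> region \<nu> \<longleftrightarrow> snd p \<le> a \<and> fst p \<le> \<rho> (snd p)"
  by (simp add: real_pt_def region_nu)

text \<open>Rows widen upwards, so a rectangle spanned by two points of the region lies in it as
  soon as its lower right corner does. For \<open>p\<close> southwest of \<open>q\<close> this
  corner is \<open>(fst q, snd p)\<close>.\<close>

lemma incompatible_iff:
  assumes "real_pt p \<in> region \<nu>" "real_pt q \<in> region \<nu>"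
  shows "incompatible \<nu> p q \<longleftrightarrow>
    southwest p q \<and> fst q \<le> \<rho> (snd p) \<or> southwest q p \<and> fst p \<le> \<rho> (snd q)"
proof -
  have *: "rect p q \<subseteq> region \<nu> \<longleftrightarrow> fst q \<le> \<rho> (snd p)"
    if "southwest p q" and R: "real_pt q \<in> region \<nu>" for p q
  proof
    assume "rect p q \<subseteq> region \<nu>"
    moreover have "(real (fst q), real (snd p)) \<in> rect p q"
      using that by (auto simp: rect_def southwest_def)
    ultimately show "fst q \<le> \<rho> (snd p)"
      by (auto simp: region_nu)
  next
    assume c: "fst q \<le> \<rho> (snd p)"
    show "rect p q \<subseteq> region \<nu>"
    proof safe
      fix x y assume "(x, y) \<in> rect p q"
      then have xy: "fst p \<le> x" "x \<le> fst q" "snd p \<le> y" "y \<le> snd q"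
        using that by (auto simp: rect_def southwest_def)
      have "snd p \<le> nat \<lfloor>y\<rfloor>"
        using xy by linarith
      from row_end_mono[OF this, of \<nu>] show "(x, y) \<in> region \<nu>"
        using xy c R by (auto simp: region_nu real_pt_region)
    qed
  qed
  have "rect p q = rect q p"
    by (auto simp: rect_def)
  then show ?thesis
    unfolding incompatible_def using *[of p q] *[of q p] assms by blast
qed

lemma horiz_nu:
  assumes "snd p \<le> a" "fst p \<le> \<rho> (snd p)"
  shows "horiz \<nu> p = \<rho> (snd p) - fst p"
proof -
  have "closed_segment (real_pt p) (real_pt (fst p + k, snd p)) \<subseteq> region \<nu> \<longleftrightarrow>
      k \<le> \<rho> (snd p) - fst p" for k
  proof
    assume "closed_segment (real_pt p) (real_pt (fst p + k, snd p)) \<subseteq> region \<nu>"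
    then have "real_pt (fst p + k, snd p) \<in> region \<nu>"
      by auto
    then show "k \<le> \<rho> (snd p) - fst p"
      by (simp add: real_pt_region le_diff_conv2 add.commute)
  next
    assume k: "k \<le> \<rho> (snd p) - fst p"
    show "closed_segment (real_pt p) (real_pt (fst p + k, snd p)) \<subseteq> region \<nu>"
    proof safe
      fix x y assume "(x, y) \<in> closed_segment (real_pt p) (real_pt (fst p + k, snd p))"
      then obtain u :: real where u: "0 \<le> u" "u \<le> 1" "x = fst p + u * k" "y = snd p"
        by (auto simp: in_segment real_pt_def algebra_simps)
      have "u * k \<le> k" "0 \<le> u * k"
        using u by (auto simp: mult_left_le_one_le)
      then show "(x, y) \<in> region \<nu>"
        using u k assms by (simp add: region_nu)
    qed
  qed
  then have "{k. closed_segment (real_pt p) (real_pt (fst p + k, snd p)) \<subseteq> region \<nu>} =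
      {..\<rho> (snd p) - fst p}"
    by auto
  then show ?thesis
    unfolding horiz_def by (auto intro!: Max_eqI)
qed

lemma vertex_le_rho:
  assumes "\<And>i. i < length w \<Longrightarrow> w ! i \<noteq> North \<Longrightarrow> fst (vertex w i) < \<rho> (snd (vertex w i))"
  shows "i \<le> length w \<Longrightarrow> fst (vertex w i) \<le> \<rho> (snd (vertex w i))"
proof (induction i)
  case (Suc i)
  have "fst (vertex w (Suc i)) \<le> \<rho> (snd (vertex w i))"
    using Suc assms[of i] by (cases "w ! i = North") (auto simp: vertex_Suc fst_move Suc_le_eq)
  also have "\<dots> \<le> \<rho> (snd (vertex w (Suc i)))"
    using Suc.prems by (intro row_end_mono) (auto simp: vertex_Suc snd_move)
  finally show ?case .
qed simp

text \<open>A diagonal step with both ends in the region can leave it in between, so testing the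
  ends is not enough. The row of the starting point decides: a step to the right, level or diagonal,
  needs one more unit of room in that row.\<close>

lemma schroeder_path_iff:
  "schroeder_path \<nu> w \<longleftrightarrow> endpoint w = (b, a) \<and>
     (\<forall>i<length w. w ! i \<noteq> North \<longrightarrow> fst (vertex w i) < \<rho> (snd (vertex w i)))"
proof (intro iffI conjI allI impI)
  assume w: "schroeder_path \<nu> w"
  then show "endpoint w = (b, a)"
    by (simp add: schroeder_path_def endpoint_nu)
  fix i assume i: "i < length w" "w ! i \<noteq> North"
  let ?p = "vertex w i"
  \<comment> \<open>The height of the midpoint of a diagonal step still has the row of the starting
    point as its floor. Lying half a unit to the right of an integer abscissa, the midpoint yields a
    strict inequality between integers.\<close>
  have "midpoint (real_pt ?p) (real_pt (vertex w (Suc i))) \<in>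
      closed_segment (real_pt ?p) (real_pt (vertex w (Suc i)))"
    by (rule midpoint_in_closed_segment)
  then have "midpoint (real_pt ?p) (real_pt (vertex w (Suc i))) \<in> curve w"
    using i unfolding curve_def by blast
  then have "midpoint (real_pt ?p) (real_pt (vertex w (Suc i))) \<in> region \<nu>"
    using w by (auto simp: schroeder_path_def)
  moreover have "midpoint (real_pt ?p) (real_pt (vertex w (Suc i))) =
      (fst ?p + 1/2, snd ?p + (if w ! i = East then 0 else 1/2))"
    using i by (cases "w ! i") (auto simp: vertex_Suc real_pt_def fst_move snd_move midpoint_def)
  moreover have "nat \<lfloor>real (snd ?p) + (if w ! i = East then 0 else 1/2)\<rfloor> = snd ?p"
    by (cases "w ! i = East") (auto simp: nat_eq_iff floor_eq_iff)
  ultimately have "fst ?p + 1/2 \<le> \<rho> (snd ?p)"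
    by (simp only: region_nu)
  then show "fst ?p < \<rho> (snd ?p)"
    by linarith
next
  assume *: "endpoint w = (b, a) \<and>
     (\<forall>i<length w. w ! i \<noteq> North \<longrightarrow> fst (vertex w i) < \<rho> (snd (vertex w i)))"
  then have le: "fst (vertex w i) \<le> \<rho> (snd (vertex w i))" if "i \<le> length w" for i
    using that by (intro vertex_le_rho) auto
  have "curve w \<subseteq> region \<nu>"
  proof -
    have "(0, 0) \<in> region \<nu>"
      by (simp add: region_nu)
    moreover have "(x, y) \<in> region \<nu>"
      if i: "i < length w" and seg: "(x, y) \<in> closed_segment (real_pt (vertex w i)) (real_pt (vertex w (Suc i)))"
      for x y i
    proof -
      obtain u :: real where u: "0 \<le> u" "u \<le> 1" "x = fst (vertex w i) + (if w ! i = North then 0 else u)"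
        "y = snd (vertex w i) + (if w ! i = East then 0 else u)"
        using i seg by (cases "w ! i")
          (auto simp: in_segment real_pt_def vertex_Suc fst_move snd_move algebra_simps)
      have "snd (vertex w (Suc i)) \<le> a"
        using vertex_mono[of "Suc i" "length w" w] i * by (simp add: vertex_length)
      then have "y \<le> a"
        using u i by (auto simp: vertex_Suc snd_move split: if_splits)
      have "snd (vertex w i) \<le> nat \<lfloor>y\<rfloor>"
        using u(1,4) by (auto simp: le_nat_iff le_floor_iff)
      from row_end_mono[OF this, of \<nu>] have "x \<le> \<rho> (nat \<lfloor>y\<rfloor>)"
        using u i le[of i] *
        by (cases "w ! i = North")
          (force, smt (verit) of_nat_less_iff of_nat_le_iff of_nat_Suc Suc_leI)
      then show ?thesis
        using u \<open>y \<le> a\<close> by (auto simp: region_nu)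
    qed
    ultimately show ?thesis
      unfolding curve_def by auto
  qed
  then show "schroeder_path \<nu> w"
    using * by (simp add: schroeder_path_def endpoint_nu)
qed

lemma schroeder_path_vertex:
  assumes "schroeder_path \<nu> w" "i \<le> length w"
  shows "snd (vertex w i) \<le> a" and "fst (vertex w i) \<le> \<rho> (snd (vertex w i))"
  using assms vertex_mono[of i "length w" w] vertex_le_rho[of w i]
  by (auto simp: vertex_length schroeder_path_iff)

section \<open>Filling the rows from right to left\<close>

text \<open>\<open>node w i\<close> is the \<open>i\<close>-th node of the tree of \<open>w\<close>. Its column is the last one available in its
  row; \<open>used w i\<close> are the columns no longer available, namely those of the earlier nodes that are
  not left by a north step.\<close>

primrec used :: "step list \<Rightarrow> nat \<Rightarrow> nat set" where
  "used w 0 = {}"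
| "used w (Suc i) = (if w ! i = North then used w i
     else insert (Max ({..\<rho> (snd (vertex w i))} - used w i)) (used w i))"

definition node :: "step list \<Rightarrow> nat \<Rightarrow> nat \<times> nat" where
  "node w i = (Max ({..\<rho> (snd (vertex w i))} - used w i), snd (vertex w i))"

lemma snd_node [simp]: "snd (node w i) = snd (vertex w i)"
  by (simp add: node_def)

lemma used_Suc: "used w (Suc i) = (if w ! i = North then used w i else insert (fst (node w i)) (used w i))"
  by (simp add: node_def)

declare used.simps(2) [simp del]

lemma finite_used: "finite (used w i)"
  by (induction i) (auto simp: used_Suc)

lemma used_mono: "i \<le> j \<Longrightarrow> used w i \<subseteq> used w j"
  by (induction j rule: dec_induct) (auto simp: used_Suc)

lemma used_iff: "x \<in> used w i \<longleftrightarrow> (\<exists>k<i. w ! k \<noteq> North \<and> fst (node w k) = x)"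
  by (induction i) (auto simp: used_Suc less_Suc_eq)

text \<open>Guarantees that the maximum in \<open>node\<close> is taken over a nonempty set at every
  vertex. It is kept apart from \<open>schroeder_path\<close> because for the word read from a tree
  it is proved first, and the path property is deduced from it.\<close>

definition flushable :: "step list \<Rightarrow> bool" where
  "flushable w \<longleftrightarrow> (\<forall>i\<le>length w. \<not> {..\<rho> (snd (vertex w i))} \<subseteq> used w i)"

text \<open>Only an inequality, since without \<open>flushable\<close> a column could be inserted
  twice. It is what proves \<open>flushable\<close> for paths.\<close>

lemma card_used_le: "i \<le> length w \<Longrightarrow> card (used w i) \<le> fst (vertex w i)"
proof (induction i)
  case (Suc i)
  then show ?case
    by (auto simp: used_Suc vertex_Suc fst_move finite_used card_insert_if)
qed simp

text \<open>Counting: at a vertex of abscissa \<open>x\<close> at most \<open>x\<close> columns are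
  used, while its row has at least \<open>x + 1\<close> columns.\<close>

lemma flushable_path:
  assumes "schroeder_path \<nu> w"
  shows "flushable w"
  unfolding flushable_def
proof (intro allI impI)
  fix i assume i: "i \<le> length w"
  have "card (used w i) < card {..\<rho> (snd (vertex w i))}"
    using card_used_le[OF i] schroeder_path_vertex[OF assms i] by simp
  then show "\<not> {..\<rho> (snd (vertex w i))} \<subseteq> used w i"
    using card_mono[OF finite_used] by (metis leD)
qed

context
  fixes w assumes w: "flushable w"
begin

lemma fst_node_in:
  assumes "i \<le> length w"
  shows "fst (node w i) \<in> {..\<rho> (snd (vertex w i))} - used w i"
  unfolding node_def fst_conv using assms w by (intro Max_in) (auto simp: flushable_def)

lemma fst_node_le: "i \<le> length w \<Longrightarrow> fst (node w i) \<le> \<rho> (snd (vertex w i))"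
  and fst_node_notin: "i \<le> length w \<Longrightarrow> fst (node w i) \<notin> used w i"
  using fst_node_in by auto

lemma fst_node_ge:
  "x \<le> \<rho> (snd (vertex w i)) \<Longrightarrow> x \<notin> used w i \<Longrightarrow> x \<le> fst (node w i)"
  unfolding node_def fst_conv by (intro Max_ge) auto

lemma fst_node_inj: "k < i \<Longrightarrow> i \<le> length w \<Longrightarrow> w ! k \<noteq> North \<Longrightarrow> fst (node w k) \<noteq> fst (node w i)"
  using fst_node_notin used_iff by blast

lemma used_subset:
  assumes "i \<le> length w"
  shows "used w i \<subseteq> {..\<rho> (snd (vertex w i))}"
proof
  fix x assume "x \<in> used w i"
  then obtain k where k: "k < i" "x = fst (node w k)"
    by (auto simp: used_iff)
  then have "x \<le> \<rho> (snd (vertex w k))"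
    using fst_node_le assms by auto
  also have "\<dots> \<le> \<rho> (snd (vertex w i))"
    using k assms vertex_mono[of k i w] by (intro row_end_mono) auto
  finally show "x \<in> {..\<rho> (snd (vertex w i))}"
    by simp
qed

text \<open>Every step that is not a north step takes up a fresh column and raises the abscissa by
  one.\<close>

lemma card_used:
  assumes "i \<le> length w"
  shows "card (used w i) = fst (vertex w i)"
  using assms
proof (induction i)
  case (Suc i)
  then show ?case
    using fst_node_notin[of i] by (simp add: used_Suc vertex_Suc fst_move finite_used)
qed simp

text \<open>The node stands in the last free column, so every column of the row is its own, a free
  one to its left, or a used one. Counting these three kinds gives the identity.\<close>

lemma card_free:
  assumes i: "i \<le> length w"
  shows "card ({..<fst (node w i)} - used w i) + fst (vertex w i) = \<rho> (snd (vertex w i))"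
proof -
  let ?x = "fst (node w i)" and ?r = "\<rho> (snd (vertex w i))"
  have "{..?r} = insert ?x (({..<?x} - used w i) \<union> used w i)"
    using fst_node_in[OF i] fst_node_ge[of _ i] used_subset[OF i] by force
  moreover have "?x \<notin> ({..<?x} - used w i) \<union> used w i"
    using fst_node_in[OF i] by auto
  ultimately have "card {..?r} = Suc (card (({..<?x} - used w i) \<union> used w i))"
    using finite_used[of w i] by simp
  also have "card (({..<?x} - used w i) \<union> used w i) = card ({..<?x} - used w i) + card (used w i)"
    using finite_used[of w i] by (intro card_Un_disjoint) auto
  finally show ?thesis
    using card_used[OF i] by simp
qed

text \<open>The nodes come in the reading order of the tree: an east step stays in the row and uses
  up its last free column, which forces the next node to the left; any other step goes up one
  row.\<close>

lemma before_node_Suc: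
  assumes i: "i < length w"
  shows "snd (node w i) < snd (node w (Suc i)) \<or>
     snd (node w i) = snd (node w (Suc i)) \<and> fst (node w (Suc i)) < fst (node w i)"
proof (cases "w ! i = East")
  case True
  then have "snd (vertex w (Suc i)) = snd (vertex w i)" "used w (Suc i) = insert (fst (node w i)) (used w i)"
    using i by (auto simp: vertex_Suc snd_move used_Suc)
  moreover have "fst (node w (Suc i)) \<in> {..\<rho> (snd (vertex w (Suc i)))} - used w (Suc i)"
    using i by (intro fst_node_in) auto
  ultimately have "fst (node w (Suc i)) < fst (node w i)"
    using fst_node_ge[of "fst (node w (Suc i))" i] by auto
  with \<open>snd (vertex w (Suc i)) = snd (vertex w i)\<close> show ?thesis
    by simp
qed (use i in \<open>simp add: vertex_Suc snd_move\<close>)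

section \<open>Horizontal distance and repeated visits to a column\<close>

text \<open>By \<open>card_free\<close>, the row end minus the abscissa counts the free columns to
  the left of the node.\<close>

lemma horiz_vertex:
  assumes i: "i \<le> length w" and top: "snd (endpoint w) \<le> a"
  shows "horiz \<nu> (vertex w i) = card ({..<fst (node w i)} - used w i)"
proof -
  have "snd (vertex w i) \<le> a"
    using vertex_mono[of i "length w" w] assms by (simp add: vertex_length)
  then show ?thesis
    using card_free[OF i] by (subst horiz_nu) auto
qed

text \<open>Between two visits of a column, all columns to its left keep their status, and the
  column itself stays free.\<close>

lemma horiz_revisit:
  assumes "w ! i = North" "i < j" "j \<le> length w" "fst (node w j) = fst (node w i)"
    and top: "snd (endpoint w) \<le> a"
  shows "horiz \<nu> (vertex w j) = horiz \<nu> (vertex w i)"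
    and "i < k \<Longrightarrow> k < j \<Longrightarrow> fst (node w k) \<noteq> fst (node w i) \<Longrightarrow>
      horiz \<nu> (vertex w i) < horiz \<nu> (vertex w k)"
proof -
  let ?x = "fst (node w i)"
  have free: "?x \<notin> used w k" if "i < k" "k \<le> j" for k
    using fst_node_notin[of j] used_mono[of k j w] that assms by auto
  \<comment> \<open>Column \<open>?x\<close> is still free at time \<open>k\<close> and rows widen
    upwards, so the last free column is not to the left of \<open>?x\<close>.\<close>
  have ge: "?x \<le> fst (node w k)" if "i < k" "k \<le> j" for k
  proof (rule fst_node_ge)
    have "\<rho> (snd (vertex w i)) \<le> \<rho> (snd (vertex w k))"
      using that assms vertex_mono[of i k w] by (intro row_end_mono) auto
    then show "?x \<le> \<rho> (snd (vertex w k))"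
      using fst_node_le[of i] assms by simp
  qed (use free that in auto)
  have same: "{..<?x} - used w k = {..<?x} - used w i" if "i < k" "k \<le> j" for k
    using that
  proof (induction k)
    case (Suc k)
    show ?case
    proof (cases "k = i")
      case True
      then show ?thesis using assms by (simp add: used_Suc)
    next
      case False
      then show ?thesis using Suc ge[of k] by (auto simp: used_Suc)
    qed
  qed simp
  show "horiz \<nu> (vertex w j) = horiz \<nu> (vertex w i)"
    using assms same[of j] by (simp add: horiz_vertex)
  show "horiz \<nu> (vertex w i) < horiz \<nu> (vertex w k)"
    if "i < k" "k < j" "fst (node w k) \<noteq> ?x"
  proof -
    \<comment> \<open>Node \<open>k\<close> lies strictly to the right of column \<open>?x\<close>,
      so the free column \<open>?x\<close> itself is counted in addition to the free columns to its
      left.\<close>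
    have "card ({..<?x} - used w i) < card ({..<fst (node w k)} - used w k)"
    proof (rule psubset_card_mono)
      show "{..<?x} - used w i \<subset> {..<fst (node w k)} - used w k"
        using same[of k] ge[of k] free[of k] that by force
    qed simp
    then show ?thesis
      using that assms by (simp add: horiz_vertex)
  qed
qed

context
  assumes endpoint_w: "endpoint w = (b, a)"
begin

text \<open>At the end \<open>b\<close> distinct columns are used and the last node stands in one
  more, which exhausts the \<open>b + 1\<close> columns.\<close>

lemma column_visited:
  assumes "x \<le> b"
  shows "x = fst (node w (length w)) \<or> x \<in> used w (length w)"
proof -
  let ?n = "length w"
  have "insert (fst (node w ?n)) (used w ?n) = {..b}"
  proof (rule card_subset_eq)
    show "insert (fst (node w ?n)) (used w ?n) \<subseteq> {..b}"
      using fst_node_le[of ?n] used_subset[of ?n] by (auto simp: vertex_length endpoint_w rho_top)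
    show "card (insert (fst (node w ?n)) (used w ?n)) = card {..b}"
      using fst_node_notin[of ?n] card_used[of ?n] by (simp add: finite_used vertex_length endpoint_w)
  qed simp
  then show ?thesis
    using assms by auto
qed

text \<open>The column is finally taken up, by the last node or by one not left by a north step.
  That node cannot precede node \<open>i\<close>, which found the column free, and it is not node
  \<open>i\<close>, which is left by a north step.\<close>

lemma column_revisited:
  assumes i: "i < length w" "w ! i = North"
  shows "\<exists>j. i < j \<and> j \<le> length w \<and> fst (node w j) = fst (node w i)"
proof -
  have "fst (node w i) \<le> b"
    using fst_node_le[of i] rho_le[of "snd (vertex w i)"] i by simp
  from column_visited[OF this] show ?thesis
  proof
    assume "fst (node w i) \<in> used w (length w)"
    then obtain k where k: "k < length w" "w ! k \<noteq> North" "fst (node w k) = fst (node w i)"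
      by (auto simp: used_iff)
    then have "\<not> k < i"
      using fst_node_inj[of k i] i by auto
    moreover have "k \<noteq> i"
      using i k by auto
    ultimately show ?thesis
      using k by (intro exI[of _ k]) auto
  qed (use i in auto)
qed

text \<open>Let \<open>j'\<close> be the first later visit to the column of node \<open>i\<close>.
  Strictly between them the horizontal distances exceed that of \<open>i\<close>; at
  \<open>j'\<close> they agree. So although \<open>last_same_horiz\<close> looks back from
  \<open>j\<close>, for a north step it holds exactly when \<open>j = j'\<close>.\<close>

lemma last_same_horiz_iff:
  assumes i: "w ! i = North" "i < j" "j \<le> length w"
  shows "last_same_horiz \<nu> w i j \<longleftrightarrow> fst (node w j) = fst (node w i) \<and>
    (\<forall>k. i < k \<and> k < j \<longrightarrow> fst (node w k) \<noteq> fst (node w i))"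
proof -
  define P where "P j \<longleftrightarrow> i < j \<and> j \<le> length w \<and> fst (node w j) = fst (node w i)" for j
  obtain j' where j': "P j'" "\<And>k. k < j' \<Longrightarrow> \<not> P k"
    using column_revisited[of i] i exists_least_iff[of P] unfolding P_def by auto
  have eq: "horiz \<nu> (vertex w j') = horiz \<nu> (vertex w i)"
    using horiz_revisit(1)[of i j'] j' i by (auto simp: P_def endpoint_w)
  have gt: "horiz \<nu> (vertex w i) < horiz \<nu> (vertex w k)" if "i < k" "k < j'" for k
    using horiz_revisit(2)[of i j' k] j' i that by (auto simp: P_def endpoint_w)
  have "last_same_horiz \<nu> w i j \<longleftrightarrow> j = j'"
  proof
    assume l: "last_same_horiz \<nu> w i j"
    have "\<not> j < j'"
      using gt[of j] l by (auto simp: last_same_horiz_def)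
    moreover have "\<not> j' < j"
      using eq l j' by (auto simp: last_same_horiz_def P_def)
    ultimately show "j = j'"
      by simp
  next
    assume "j = j'"
    then show "last_same_horiz \<nu> w i j"
      using eq gt i by (fastforce simp: last_same_horiz_def)
  qed
  also have "\<dots> \<longleftrightarrow> P j \<and> (\<forall>k. i < k \<and> k < j \<longrightarrow> \<not> P k)"
    using j' by (metis P_def linorder_neqE_nat)
  finally show ?thesis
    using i by (auto simp: P_def)
qed

end

text \<open>With the last node in column 0, this column is free throughout. It is thus a free column
  to the left of every node not left by a north step, and \<open>card_free\<close> turns this into
  the room that \<open>schroeder_path_iff\<close> asks for.\<close>

lemma schroeder_path_if_flushable:
  assumes "node w (length w) = (0, a)"
  shows "schroeder_path \<nu> w"
proof -
  let ?n = "length w"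
  have top: "snd (endpoint w) = a"
    using assms by (metis snd_node snd_conv vertex_length)
  have "fst (endpoint w) = b"
    using card_free[OF le_refl] assms by (simp add: vertex_length top rho_top)
  moreover have "fst (vertex w i) < \<rho> (snd (vertex w i))" if i: "i < ?n" "w ! i \<noteq> North" for i
  proof -
    have "0 \<notin> used w ?n"
      using fst_node_notin[of ?n] assms by simp
    then have "0 \<notin> used w i" "fst (node w i) \<noteq> 0"
      using used_mono[of i ?n w] i by (auto simp: used_iff)
    then have "{..<fst (node w i)} - used w i \<noteq> {}"
      by auto
    then have "card ({..<fst (node w i)} - used w i) > 0"
      by (simp add: card_gt_0_iff)
    then show ?thesis
      using card_free[of i] i by simp
  qed
  ultimately show ?thesis
    using top by (simp add: schroeder_path_iff prod_eq_iff)
qed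

end

end

section \<open>Reading a tree as a path\<close>

definition before :: "nat \<times> nat \<Rightarrow> nat \<times> nat \<Rightarrow> bool" where
  "before p q \<longleftrightarrow> snd p < snd q \<or> snd p = snd q \<and> fst q < fst p"

text \<open>Provides the sorted list of a finite set in the reading order, from which
  \<open>nodes\<close> is taken.\<close>

interpretation reading: linorder "\<lambda>p q. p = q \<or> before p q" before
  by standard (auto simp: before_def prod_eq_iff)

abbreviation nodes :: "(nat \<times> nat) set \<Rightarrow> (nat \<times> nat) list" where
  "nodes \<equiv> reading.sorted_list_of_set"

definition has_left :: "(nat \<times> nat) set \<Rightarrow> nat \<times> nat \<Rightarrow> bool" where
  "has_left T q \<longleftrightarrow> (\<exists>p\<in>T. snd p = snd q \<and> fst p < fst q)"

definition has_above :: "(nat \<times> nat) set \<Rightarrow> nat \<times> nat \<Rightarrow> bool" where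
  "has_above T q \<longleftrightarrow> (\<exists>p\<in>T. fst p = fst q \<and> snd q < snd p)"

text \<open>For nodes of a tree, \<open>has_left\<close> and \<open>has_above\<close> exclude each
  other; see \<open>not_left_and_above\<close>.\<close>

definition node_step :: "(nat \<times> nat) set \<Rightarrow> nat \<times> nat \<Rightarrow> step" where
  "node_step T q = (if has_left T q then East else if has_above T q then North else Diag)"

text \<open>\<open>butlast\<close> drops the root, which is read last and contributes no
  step.\<close>

definition tree_path :: "(nat \<times> nat) set \<Rightarrow> step list" where
  "tree_path T = map (node_step T) (butlast (nodes T))"

lemma nodes_eqI:
  assumes "sorted_wrt before ns" "set ns = T"
  shows "nodes T = ns"
  using assms reading.strict_sorted_equal[OF _ assms(1)] reading.strict_sorted_list_of_set
  by (metis List.finite_set reading.set_sorted_list_of_set)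

context nu_path
begin

lemma schroeder_tree_iff:
  "schroeder_tree \<nu> T \<longleftrightarrow>
     (\<forall>p\<in>T. snd p \<le> a \<and> fst p \<le> \<rho> (snd p)) \<and>
     (\<forall>p\<in>T. \<forall>q\<in>T. southwest p q \<longrightarrow> \<rho> (snd p) < fst q) \<and>
     (0, a) \<in> T \<and> (\<forall>y\<le>a. \<exists>p\<in>T. snd p = y) \<and> (\<forall>x\<le>b. \<exists>p\<in>T. fst p = x)"
proof -
  have "(\<forall>p\<in>T. \<forall>q\<in>T. \<not> incompatible \<nu> p q) \<longleftrightarrow> (\<forall>p\<in>T. \<forall>q\<in>T. southwest p q \<longrightarrow> \<rho> (snd p) < fst q)"
    if "\<forall>p\<in>T. real_pt p \<in> region \<nu>"
    using that by (auto simp: incompatible_iff not_le)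
  then show ?thesis
    unfolding schroeder_tree_def
    by (auto simp: real_pt_region tree_root_def endpoint_nu Bex_def)
qed

section \<open>From a path to a tree\<close>

text \<open>On Schroeder paths this is the inverse of \<open>tree_path\<close>.\<close>

definition path_tree :: "step list \<Rightarrow> (nat \<times> nat) set" where
  "path_tree w = node w ` {..length w}"

text \<open>The nodes are generated in reading order, so it suffices to compare each step with the
  neighbours of its node. A north step leaves the column free to be visited again higher up, and any
  other step closes it; an east step is followed by a node in the same row, and any other step ends
  the row.\<close>

lemma path_tree:
  assumes w: "schroeder_path \<nu> w"
  shows "schroeder_tree \<nu> (path_tree w)" and "tree_path (path_tree w) = w"
proof -
  let ?n = "length w" and ?T = "path_tree w"
  have fl: "flushable w"
    using w by (rule flushable_path)
  have ep: "endpoint w = (b, a)"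
    using w by (simp add: schroeder_path_iff)
  have "sorted_wrt before (map (node w) [0..<Suc ?n])"
    using before_node_Suc[OF fl]
    by (subst sorted_wrt_iff_nth_Suc_transp) (auto simp: transp_def before_def simp del: upt_Suc)
  then have nodes: "nodes ?T = map (node w) [0..<Suc ?n]"
    by (intro nodes_eqI) (auto simp: path_tree_def simp del: upt_Suc)
  have before: "before (node w i) (node w j)" if "i < j" "j \<le> ?n" for i j
    using sorted_wrt_nth_less[OF \<open>sorted_wrt before _\<close>, of i j] that by (simp del: upt_Suc)
  have row: "snd (node w i) < snd (node w j)" if "i < j" "j \<le> ?n" "w ! i \<noteq> East" for i j
    using vertex_mono[of "Suc i" j w] that by (simp add: vertex_Suc snd_move)
  have N: "has_above ?T (node w i)" if i: "i < ?n" "w ! i = North" for i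
  proof -
    obtain j where "i < j" "j \<le> ?n" "fst (node w j) = fst (node w i)"
      using column_revisited[OF fl ep i] by blast
    then show ?thesis
      using row[of i j] i unfolding has_above_def path_tree_def
      by (intro bexI[of _ "node w j"]) auto
  qed
  have notN: "\<not> has_above ?T (node w i)" if i: "i < ?n" "w ! i \<noteq> North" for i
  proof
    assume "has_above ?T (node w i)"
    then obtain j where j: "j \<le> ?n" "fst (node w j) = fst (node w i)" "snd (node w i) < snd (node w j)"
      by (auto simp: has_above_def path_tree_def)
    then have "i < j"
      using vertex_mono[of j i w] i by (simp add: not_le[symmetric]) (metis leI le_less_trans less_imp_le)
    then show False
      using fst_node_inj[OF fl, of i j] i j by auto
  qed
  have E: "has_left ?T (node w i)" if i: "i < ?n" "w ! i = East" for i
    using before_node_Suc[OF fl i(1)] i unfolding has_left_def path_tree_def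
    by (intro bexI[of _ "node w (Suc i)"]) (auto simp: vertex_Suc snd_move)
  have notE: "\<not> has_left ?T (node w i)" if i: "i < ?n" "w ! i \<noteq> East" for i
  proof
    assume "has_left ?T (node w i)"
    then obtain j where j: "j \<le> ?n" "snd (node w j) = snd (node w i)" "fst (node w j) < fst (node w i)"
      by (auto simp: has_left_def path_tree_def)
    then show False
      using before[of j i] row[of i j] i by (cases i j rule: linorder_cases) (auto simp: before_def)
  qed
  show "tree_path ?T = w"
  proof (rule nth_equalityI)
    fix i assume "i < length (tree_path ?T)"
    then have i: "i < ?n"
      by (simp add: tree_path_def nodes)
    then have "tree_path ?T ! i = node_step ?T (node w i)"
      by (simp add: tree_path_def nodes butlast_append)
    then show "tree_path ?T ! i = w ! i"
      using i N notN E notE by (cases "w ! i") (auto simp: node_step_def)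
  qed (simp add: tree_path_def nodes)
  have in_T: "node w i \<in> ?T" if "i \<le> ?n" for i
    using that by (auto simp: path_tree_def)
  have "snd p \<le> a \<and> fst p \<le> \<rho> (snd p)" if "p \<in> ?T" for p
    using that fst_node_le[OF fl] schroeder_path_vertex[OF w] by (auto simp: path_tree_def)
  \<comment> \<open>A column still free at node \<open>q\<close> was free at the earlier node
    \<open>p\<close>. If it lay within the row of \<open>p\<close>, the maximum would have placed
    \<open>p\<close> there or further right.\<close>
  moreover have "\<rho> (snd p) < fst q" if pq: "p \<in> ?T" "q \<in> ?T" and sw: "southwest p q" for p q
  proof (rule ccontr)
    obtain i j where ij: "p = node w i" "i \<le> ?n" "q = node w j" "j \<le> ?n"
      using pq by (auto simp: path_tree_def)
    then have "i < j"
      using sw before[of j i] by (cases i j rule: linorder_cases) (auto simp: southwest_def before_def)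
    then have "fst q \<notin> used w i"
      using fst_node_notin[OF fl, of j] used_mono[of i j w] ij by auto
    moreover assume "\<not> \<rho> (snd p) < fst q"
    ultimately show False
      using fst_node_ge[OF fl, of "fst q" i] sw ij by (auto simp: southwest_def)
  qed
  moreover have "(0, a) \<in> ?T"
  proof -
    \<comment> \<open>No free column lies to the left of column 0, so by \<open>card_free\<close>
      the vertex of a node there is at the row end, from which only a north step is
      possible.\<close>
    have "0 \<notin> used w ?n"
    proof
      assume "0 \<in> used w ?n"
      then obtain i where i: "i < ?n" "w ! i \<noteq> North" "fst (node w i) = 0"
        by (auto simp: used_iff)
      then show False
        using card_free[OF fl, of i] w by (auto simp: schroeder_path_iff)
    qed
    then have "fst (node w ?n) = 0"
      using column_visited[OF fl ep, of 0] by auto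
    then have "node w ?n = (0, a)"
      by (simp add: prod_eq_iff vertex_length ep)
    then show ?thesis
      using in_T[of ?n] by simp
  qed
  moreover have "\<exists>p\<in>?T. snd p = y" if y: "y \<le> a" for y
  proof -
    \<comment> \<open>Heights grow by at most one per step, so none is skipped.\<close>
    have "\<exists>i\<le>m. snd (vertex w i) = y" if "m \<le> ?n" "y \<le> snd (vertex w m)" for m
      using that
    proof (induction m)
      case (Suc m)
      show ?case
      proof (cases "y \<le> snd (vertex w m)")
        case True
        then show ?thesis using Suc by (meson Suc_leD le_SucI)
      next
        case False
        then have "snd (vertex w (Suc m)) = y"
          using Suc.prems by (auto simp: vertex_Suc snd_move split: if_splits)
        then show ?thesis by auto
      qed
    qed simp
    from this[of ?n] obtain i where "i \<le> ?n" "snd (vertex w i) = y"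
      using y by (auto simp: vertex_length ep)
    then show ?thesis
      using in_T[of i] by (intro bexI[of _ "node w i"]) auto
  qed
  moreover have "\<exists>p\<in>?T. fst p = x" if x: "x \<le> b" for x
  proof -
    obtain i where "i \<le> ?n" "x = fst (node w i)"
      using column_visited[OF fl ep x] unfolding used_iff by (metis le_refl less_imp_le)
    then show ?thesis
      using in_T by blast
  qed
  ultimately show "schroeder_tree \<nu> ?T"
    by (simp add: schroeder_tree_iff)
qed

section \<open>From a tree to a path\<close>

context
  fixes T assumes T: "schroeder_tree \<nu> T"
begin

lemma set_nodes: "set (nodes T) = T"
  using T by (simp add: finite_schroeder_tree)

lemma sorted_nodes: "sorted_wrt before (nodes T)"
  by (rule reading.strict_sorted_list_of_set)

lemma distinct_nodes: "distinct (nodes T)"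
  by (rule reading.distinct_sorted_list_of_set)

lemma tree_bounds: "p \<in> T \<Longrightarrow> snd p \<le> a" "p \<in> T \<Longrightarrow> fst p \<le> \<rho> (snd p)"
  using T by (auto simp: schroeder_tree_iff)

lemma tree_southwest: "p \<in> T \<Longrightarrow> q \<in> T \<Longrightarrow> southwest p q \<Longrightarrow> \<rho> (snd p) < fst q"
  using T by (auto simp: schroeder_tree_iff)

lemma root_in: "(0, a) \<in> T"
  using T by (auto simp: schroeder_tree_iff)

lemma row_nonempty: "y \<le> a \<Longrightarrow> \<exists>p\<in>T. snd p = y"
  using T by (auto simp: schroeder_tree_iff)

lemma col_nonempty: "x \<le> b \<Longrightarrow> \<exists>p\<in>T. fst p = x"
  using T by (auto simp: schroeder_tree_iff)

text \<open>A node to the left of \<open>q\<close> is southwest of a node above \<open>q\<close>,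
  and the lower right corner of their rectangle is \<open>q\<close> itself, a point of the
  region.\<close>

lemma not_left_and_above: "q \<in> T \<Longrightarrow> has_left T q \<Longrightarrow> has_above T q \<Longrightarrow> False"
  using tree_southwest tree_bounds(2)
  unfolding has_left_def has_above_def southwest_def by (metis leD)

lemma node_step_North: "q \<in> T \<Longrightarrow> node_step T q = North \<longleftrightarrow> has_above T q"
  using not_left_and_above[of q] by (auto simp: node_step_def)

lemma node_step_East: "node_step T q = East \<longleftrightarrow> has_left T q"
  by (auto simp: node_step_def)

lemma nodes_last: "nodes T \<noteq> []" "last (nodes T) = (0, a)"
proof -
  show "nodes T \<noteq> []"
    using root_in set_nodes by force
  have "(0, a) = last (nodes T) \<or> before (0, a) (last (nodes T))"
    using sorted_nodes root_in \<open>nodes T \<noteq> []\<close> set_nodes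
    by (cases "nodes T" rule: rev_cases) (auto simp: sorted_wrt_append)
  moreover have "last (nodes T) \<in> T"
    using \<open>nodes T \<noteq> []\<close> set_nodes last_in_set by blast
  ultimately show "last (nodes T) = (0, a)"
    using tree_bounds(1)[of "last (nodes T)"] by (auto simp: before_def)
qed

lemma length_nodes: "length (nodes T) = Suc (length (tree_path T))"
  using nodes_last(1) by (cases "nodes T" rule: rev_cases) (auto simp: tree_path_def)

lemma nth_tree_path: "i < length (tree_path T) \<Longrightarrow> tree_path T ! i = node_step T (nodes T ! i)"
  by (simp add: tree_path_def nth_butlast)

lemma nth_nodes_in: "i \<le> length (tree_path T) \<Longrightarrow> nodes T ! i \<in> T"
  by (metis set_nodes length_nodes nth_mem less_Suc_eq_le)

lemma nodes_index:
  assumes "p \<in> T"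
  obtains i where "i \<le> length (tree_path T)" "p = nodes T ! i"
proof -
  have "p \<in> set (nodes T)"
    using assms set_nodes by blast
  then obtain i where "i < length (nodes T)" "nodes T ! i = p"
    unfolding in_set_conv_nth by blast
  then show thesis
    using that[of i] unfolding length_nodes less_Suc_eq_le by blast
qed

lemma before_nodes: "i < j \<Longrightarrow> j \<le> length (tree_path T) \<Longrightarrow> before (nodes T ! i) (nodes T ! j)"
  using sorted_wrt_nth_less[OF sorted_nodes, of i j] length_nodes by simp

lemma before_nodes_iff:
  assumes "i \<le> length (tree_path T)" "j \<le> length (tree_path T)"
  shows "before (nodes T ! i) (nodes T ! j) \<longleftrightarrow> i < j"
  using before_nodes[of i j] before_nodes[of j i] assms
  by (cases i j rule: linorder_cases) (auto simp: before_def)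

text \<open>The rows match because no row is empty, so a step that is not an east step leads exactly
  one row up. The columns match by strong induction: the used columns are those whose topmost node
  was read before, and compatibility forces each node into the last remaining column.\<close>

lemma nodes_node:
  assumes "i \<le> length (tree_path T)"
  shows "nodes T ! i = node (tree_path T) i" and "fst (nodes T ! i) \<notin> used (tree_path T) i"
proof -
  let ?w = "tree_path T" and ?ns = "nodes T"
  let ?n = "length ?w"
  have row: "snd (?ns ! i) = snd (vertex ?w i)" if "i \<le> ?n" for i
    using that
  proof (induction i)
    case 0
    obtain p where p: "p \<in> T" "snd p = 0"
      using row_nonempty[of 0] by blast
    from p(1) obtain j where j: "j \<le> ?n" "p = ?ns ! j"
      by (rule nodes_index)
    then show ?case
      using before_nodes[of 0 j] p(2) by (cases "j = 0") (auto simp: before_def)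
  next
    case (Suc i)
    have next_row: "snd (?ns ! Suc i) \<le> snd q" if "q \<in> T" "before (?ns ! i) q" for q
    proof -
      from that(1) obtain j where j: "j \<le> ?n" "q = ?ns ! j"
        by (rule nodes_index)
      then have "i < j"
        using that Suc.prems before_nodes_iff[of i j] by simp
      then show ?thesis
        using before_nodes[of "Suc i" j] j by (cases "j = Suc i") (auto simp: before_def)
    qed
    have bef: "before (?ns ! i) (?ns ! Suc i)"
      using Suc.prems by (intro before_nodes) auto
    show ?case
    proof (cases "has_left T (?ns ! i)")
      case True
      then obtain q where "q \<in> T" "snd q = snd (?ns ! i)" "fst q < fst (?ns ! i)"
        by (auto simp: has_left_def)
      then have "snd (?ns ! Suc i) = snd (?ns ! i)"
        using next_row[of q] bef by (auto simp: before_def)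
      then show ?thesis
        using Suc True by (simp add: vertex_Suc snd_move nth_tree_path node_step_East)
    next
      case False
      then have up: "snd (?ns ! i) < snd (?ns ! Suc i)"
        using bef nth_nodes_in[OF Suc.prems] by (auto simp: before_def has_left_def)
      then have "Suc (snd (?ns ! i)) \<le> a"
        using tree_bounds(1)[OF nth_nodes_in[OF Suc.prems]] by simp
      then obtain q where "q \<in> T" "snd q = Suc (snd (?ns ! i))"
        using row_nonempty by blast
      then have "snd (?ns ! Suc i) = Suc (snd (?ns ! i))"
        using next_row[of q] up by (auto simp: before_def)
      then show ?thesis
        using Suc False by (simp add: vertex_Suc snd_move nth_tree_path node_step_East)
    qed
  qed
  have "?ns ! i = node ?w i \<and> fst (?ns ! i) \<notin> used ?w i"
    using assms
  proof (induction i rule: less_induct)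
    case (less i)
    have used: "x \<in> used ?w i \<longleftrightarrow> (\<exists>k<i. \<not> has_above T (?ns ! k) \<and> fst (?ns ! k) = x)" for x
    proof -
      have "?w ! k \<noteq> North \<longleftrightarrow> \<not> has_above T (?ns ! k)" "fst (node ?w k) = fst (?ns ! k)"
        if "k < i" for k
        using that less nth_nodes_in[of k] by (simp_all add: nth_tree_path node_step_North)
      then show ?thesis
        unfolding used_iff by auto
    qed
    have "fst (?ns ! i) \<notin> used ?w i"
    proof
      assume "fst (?ns ! i) \<in> used ?w i"
      then obtain k where "k < i" "\<not> has_above T (?ns ! k)" "fst (?ns ! k) = fst (?ns ! i)"
        using used by blast
      then show False
        using before_nodes[of k i] nth_nodes_in[OF less.prems] less.prems
        by (auto simp: before_def has_above_def)
    qed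
    moreover have "x \<le> fst (?ns ! i)" if x: "x \<le> \<rho> (snd (?ns ! i))" "x \<notin> used ?w i" for x
    proof (rule ccontr)
      assume gt: "\<not> x \<le> fst (?ns ! i)"
      \<comment> \<open>Compatibility forbids the topmost node \<open>p\<close> of column
        \<open>x\<close> to lie northeast of node \<open>i\<close>, so \<open>p\<close> was read
        before it. Having nothing above it, \<open>p\<close> has already used up column
        \<open>x\<close>.\<close>
      define C where "C = {p \<in> T. fst p = x}"
      have "finite C" "C \<noteq> {}"
        using col_nonempty[of x] x rho_le[of "snd (?ns ! i)"] finite_schroeder_tree[OF T] by (auto simp: C_def)
      then obtain p where p: "p \<in> C" "Max (snd ` C) = snd p"
        using obtains_MAX[of C snd] by metis
      have "snd q \<le> snd p" if "q \<in> C" for q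
        using Max_ge[of "snd ` C" "snd q"] \<open>finite C\<close> that p(2) by simp
      note p = p(1) this
      have top: "\<not> has_above T p"
        using p by (fastforce simp: has_above_def C_def)
      have "p \<in> T"
        using p by (simp add: C_def)
      then obtain k where k: "k \<le> ?n" "p = ?ns ! k"
        by (rule nodes_index)
      have "\<not> southwest (?ns ! i) p"
        using tree_southwest[of "?ns ! i" p] nth_nodes_in[OF less.prems] p x by (auto simp: C_def)
      then have "before p (?ns ! i)"
        using gt p by (auto simp: southwest_def before_def C_def)
      then have "k < i"
        using k before_nodes_iff[of k i] less.prems by simp
      then show False
        using used[of x] x k top p by (auto simp: C_def)
    qed
    moreover have "fst (?ns ! i) \<le> \<rho> (snd (?ns ! i))"
      using tree_bounds nth_nodes_in less.prems by blast
    ultimately have "Max ({..\<rho> (snd (?ns ! i))} - used ?w i) = fst (?ns ! i)"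
      by (intro Max_eqI) auto
    then show ?case
      using row[OF less.prems] \<open>fst (?ns ! i) \<notin> used ?w i\<close> by (simp add: node_def prod_eq_iff)
  qed
  then show "?ns ! i = node ?w i" and "fst (?ns ! i) \<notin> used ?w i"
    by auto
qed

lemma flushable_tree_path: "flushable (tree_path T)"
  unfolding flushable_def
proof (intro allI impI)
  fix i assume i: "i \<le> length (tree_path T)"
  then have "fst (nodes T ! i) \<le> \<rho> (snd (vertex (tree_path T) i))"
    using nodes_node(1)[OF i] tree_bounds(2)[OF nth_nodes_in[OF i]] by simp
  then show "\<not> {..\<rho> (snd (vertex (tree_path T) i))} \<subseteq> used (tree_path T) i"
    using nodes_node(2)[OF i] by auto
qed

lemma schroeder_path_tree_path: "schroeder_path \<nu> (tree_path T)"
proof (rule schroeder_path_if_flushable[OF flushable_tree_path])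
  have "last (nodes T) = nodes T ! length (tree_path T)"
    unfolding last_conv_nth[OF nodes_last(1)] length_nodes by simp
  then show "node (tree_path T) (length (tree_path T)) = (0, a)"
    using nodes_last(2) nodes_node(1)[OF le_refl] by simp
qed

lemma path_tree_tree_path: "path_tree (tree_path T) = T"
proof (intro equalityI subsetI)
  fix p assume "p \<in> path_tree (tree_path T)"
  then obtain i where "i \<le> length (tree_path T)" "p = node (tree_path T) i"
    by (auto simp: path_tree_def)
  then show "p \<in> T"
    using nodes_node(1)[of i] nth_nodes_in[of i] by simp
next
  fix p assume "p \<in> T"
  then obtain i where "i \<le> length (tree_path T)" "p = nodes T ! i"
    by (rule nodes_index)
  then show "p \<in> path_tree (tree_path T)"
    using nodes_node(1)[of i] by (auto simp: path_tree_def)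
qed

end

lemma bij_betw_tree_path: "bij_betw tree_path (schroeder_trees \<nu>) (schroeder_paths \<nu>)"
  by (rule bij_betw_byWitness[of _ path_tree])
    (auto simp: schroeder_trees_def schroeder_paths_def path_tree path_tree_tree_path
      schroeder_path_tree_path)

end

section \<open>Removing a node\<close>

lemma first_left_ex:
  assumes "has_left T q"
  shows "\<exists>p. first_left T q p"
proof -
  let ?P = "\<lambda>p. p \<in> T \<and> snd p = snd q \<and> fst p < fst q"
  obtain k where "?P k"
    using assms by (auto simp: has_left_def)
  then have "\<exists>p. ?P p \<and> (\<forall>s. ?P s \<longrightarrow> fst s \<le> fst p)"
    by (rule ex_has_greatest_nat[where b = "fst q"]) simp
  then show ?thesis
    unfolding first_left_def by blast
qed

lemma first_above_ex:
  assumes "has_above T q"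
  shows "\<exists>p. first_above T q p"
proof -
  let ?P = "\<lambda>p. p \<in> T \<and> fst p = fst q \<and> snd q < snd p"
  obtain k where "?P k"
    using assms by (auto simp: has_above_def)
  then have "\<exists>p. ?P p \<and> (\<forall>s. ?P s \<longrightarrow> snd p \<le> snd s)"
    by (rule ex_has_least_nat)
  then show ?thesis
    unfolding first_above_def by blast
qed

lemma first_right_ex:
  assumes "k \<in> T" "snd k = snd q" "fst q < fst k"
  shows "\<exists>p. first_right T q p"
proof -
  let ?P = "\<lambda>p. p \<in> T \<and> snd p = snd q \<and> fst q < fst p"
  have "?P k"
    using assms by simp
  then have "\<exists>p. ?P p \<and> (\<forall>s. ?P s \<longrightarrow> fst p \<le> fst s)"
    by (rule ex_has_least_nat)
  then show ?thesis
    unfolding first_right_def by blast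
qed

lemma first_below_ex:
  assumes "k \<in> T" "fst k = fst q" "snd k < snd q"
  shows "\<exists>p. first_below T q p"
proof -
  let ?P = "\<lambda>p. p \<in> T \<and> fst p = fst q \<and> snd p < snd q"
  have "?P k"
    using assms by simp
  then have "\<exists>p. ?P p \<and> (\<forall>s. ?P s \<longrightarrow> snd s \<le> snd p)"
    by (rule ex_has_greatest_nat[where b = "snd q"]) simp
  then show ?thesis
    unfolding first_below_def by blast
qed

lemma first_right_unique: "first_right T r s \<Longrightarrow> first_right T r n \<longleftrightarrow> n = s"
  unfolding first_right_def by (metis le_antisym prod_eqI)

lemma first_below_unique: "first_below T r s \<Longrightarrow> first_below T r n \<longleftrightarrow> n = s"
  unfolding first_below_def by (metis le_antisym prod_eqI)

text \<open>A node to the left of \<open>r\<close> is also to the left of everything right of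
  \<open>r\<close>. So only the right neighbour of a leftmost \<open>r\<close> loses its last node
  to the left.\<close>

lemma has_left_remove:
  assumes "r \<in> T" "n \<in> T" "n \<noteq> r"
  shows "has_left (T - {r}) n \<longleftrightarrow> has_left T n \<and> \<not> (first_right T r n \<and> \<not> has_left T r)"
proof
  assume "has_left (T - {r}) n"
  then obtain p where p: "p \<in> T" "p \<noteq> r" "snd p = snd n" "fst p < fst n"
    by (auto simp: has_left_def)
  have "has_left T r" if "first_right T r n"
    using that p unfolding first_right_def has_left_def
    by (metis linorder_neqE_nat not_le prod_eqI)
  then show "has_left T n \<and> \<not> (first_right T r n \<and> \<not> has_left T r)"
    using p by (auto simp: has_left_def)
next
  assume *: "has_left T n \<and> \<not> (first_right T r n \<and> \<not> has_left T r)"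
  show "has_left (T - {r}) n"
  proof (rule ccontr)
    assume no: "\<not> has_left (T - {r}) n"
    then have r: "snd r = snd n" "fst r < fst n"
      using * by (auto simp: has_left_def)
    have "\<not> has_left T r"
      using no r unfolding has_left_def by (metis DiffI less_trans less_irrefl singletonD)
    then have "\<not> first_right T r n"
      using * by simp
    then show False
      using no r assms unfolding first_right_def has_left_def
      by (metis DiffI less_irrefl not_le singletonD)
  qed
qed

text \<open>The same argument in a column: only the lower neighbour of a topmost \<open>r\<close>
  loses its last node above.\<close>

lemma has_above_remove:
  assumes "r \<in> T" "n \<in> T" "n \<noteq> r"
  shows "has_above (T - {r}) n \<longleftrightarrow> has_above T n \<and> \<not> (first_below T r n \<and> \<not> has_above T r)"
proof
  assume "has_above (T - {r}) n"
  then obtain p where p: "p \<in> T" "p \<noteq> r" "fst p = fst n" "snd n < snd p"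
    by (auto simp: has_above_def)
  have "has_above T r" if "first_below T r n"
    using that p unfolding first_below_def has_above_def
    by (metis linorder_neqE_nat not_le prod_eqI)
  then show "has_above T n \<and> \<not> (first_below T r n \<and> \<not> has_above T r)"
    using p by (auto simp: has_above_def)
next
  assume *: "has_above T n \<and> \<not> (first_below T r n \<and> \<not> has_above T r)"
  show "has_above (T - {r}) n"
  proof (rule ccontr)
    assume no: "\<not> has_above (T - {r}) n"
    then have r: "fst r = fst n" "snd n < snd r"
      using * by (auto simp: has_above_def)
    have "\<not> has_above T r"
      using no r unfolding has_above_def by (metis DiffI less_trans less_irrefl singletonD)
    then have "\<not> first_below T r n"
      using * by simp
    then show False
      using no r assms unfolding first_below_def has_above_def
      by (metis DiffI less_irrefl not_le singletonD)
  qed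
qed

context nu_path
begin

text \<open>Compatibility passes to subsets; at stake are only the root and the occupation of the
  row and the column of \<open>r\<close>.\<close>

lemma schroeder_tree_remove:
  assumes T: "schroeder_tree \<nu> T" and "r \<noteq> (0, a)"
    and "p \<in> T" "p \<noteq> r" "snd p = snd r" "q \<in> T" "q \<noteq> r" "fst q = fst r"
  shows "schroeder_tree \<nu> (T - {r})"
proof -
  have "\<exists>p\<in>T - {r}. snd p = y" if "y \<le> a" for y
    using row_nonempty[OF T that] assms by (metis DiffI singletonD)
  moreover have "\<exists>p\<in>T - {r}. fst p = x" if "x \<le> b" for x
    using col_nonempty[OF T that] assms by (metis DiffI singletonD)
  ultimately show ?thesis
    using assms unfolding schroeder_tree_iff by blast
qed

context
  fixes T assumes T: "schroeder_tree \<nu> T"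
begin

text \<open>Supplies the non-leaf that a diagonal contraction asks for. The nearest node northwest
  of \<open>r\<close> spans a box free of other nodes, and compatibility leaves no second such box,
  so this one is the smallest.\<close>

lemma parent_Diag:
  assumes r: "r \<in> T" "r \<noteq> (0, a)" "\<not> has_left T r" "\<not> has_above T r"
  shows "\<exists>p. northwest p r \<and> parent \<nu> T r p"
proof -
  let ?C = "{p \<in> T. northwest p r}"
  \<comment> \<open>Maximizing \<open>?f\<close> over the nodes northwest of \<open>r\<close>
    minimizes the sum of the horizontal and the vertical distance to \<open>r\<close>.\<close>
  let ?f = "\<lambda>p. fst p + (a - snd p)"
  have bound: "snd s \<le> a" if "s \<in> T" for s
    using tree_bounds[OF T] that by blast
  have "0 < fst r"
  proof (rule ccontr)
    assume "\<not> 0 < fst r"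
    then have "snd r < a"
      using r(2) bound[OF r(1)] by (cases r) auto
    then show False
      using r(4) root_in[OF T] \<open>\<not> 0 < fst r\<close> by (force simp: has_above_def)
  qed
  moreover have "snd r < a"
  proof (rule ccontr)
    assume "\<not> snd r < a"
    then have "snd r = a"
      using bound[OF r(1)] by simp
    then show False
      using r(3) root_in[OF T] \<open>0 < fst r\<close> by (force simp: has_left_def)
  qed
  ultimately have "(0, a) \<in> ?C"
    using root_in[OF T] by (simp add: northwest_def)
  then have "?C \<noteq> {}"
    by blast
  have "finite ?C"
    using finite_schroeder_tree[OF T] by simp
  then obtain p where p: "p \<in> ?C" "Max (?f ` ?C) = ?f p"
    using \<open>?C \<noteq> {}\<close> by (rule obtains_MAX)
  have f: "?f s \<le> ?f p" if "s \<in> ?C" for s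
    using Max_ge[of "?f ` ?C" "?f s"] \<open>finite ?C\<close> that p(2) by simp
  have rect: "real_pt s \<in> rect r q \<longleftrightarrow> fst q \<le> fst s \<and> fst s \<le> fst r \<and> snd r \<le> snd s \<and> snd s \<le> snd q"
    if "northwest q r" for s q
    using that by (auto simp: real_pt_def rect_def northwest_def)
  have nw: "northwest s r" if "s \<in> T" "s \<noteq> r" "fst s \<le> fst r" "snd r \<le> snd s" for s
  proof -
    have "\<not> (snd s = snd r \<and> fst s < fst r)" "\<not> (fst s = fst r \<and> snd r < snd s)"
      using r(3,4) that(1) unfolding has_left_def has_above_def by blast+
    moreover have "fst s \<noteq> fst r \<or> snd s \<noteq> snd r"
      using that(2) prod_eqI by blast
    ultimately show ?thesis
      using that(3,4) unfolding northwest_def by linarith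
  qed
  have box: "isolating_box T r p"
  proof -
    have "s = p" if s: "s \<in> T" "s \<noteq> r" "real_pt s \<in> rect r p" for s
    proof -
      have s': "fst p \<le> fst s" "fst s \<le> fst r" "snd r \<le> snd s" "snd s \<le> snd p"
        using rect[of p s] p(1) s(3) by auto
      have "?f s \<le> ?f p"
        using f nw[OF s(1,2) s'(2,3)] s(1) by simp
      then have "fst s = fst p" "snd s = snd p"
        using s' bound[of p] p(1) by auto
      then show ?thesis
        by (rule prod_eqI)
    qed
    moreover have "real_pt p \<in> rect r p" "real_pt r \<in> rect r p"
      using p(1) by (auto simp: real_pt_def rect_def)
    ultimately show ?thesis
      using p(1) r(1) unfolding isolating_box_def by blast
  qed
  have unique: "q = p" if q: "isolating_box T r q" for q
  proof -
    have nwq: "northwest q r" "q \<in> T" and nwp: "northwest p r" "p \<in> T"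
      using p(1) q unfolding isolating_box_def by blast+
    have one: "s = q" if "isolating_box T r q" "s \<in> T" "northwest s r" "fst q \<le> fst s" "snd s \<le> snd q" for s q
    proof -
      have eq: "{s \<in> T. real_pt s \<in> rect r q} = {r, q}" and "northwest q r"
        using that(1) unfolding isolating_box_def by blast+
      then have "real_pt s \<in> rect r q"
        using that by (simp add: rect northwest_def)
      then have "s = r \<or> s = q"
        using that(2) eq by blast
      then show ?thesis
        using that(3) by (auto simp: northwest_def)
    qed
    \<comment> \<open>The lower right corner of the rectangle of two such nodes would lie to the
      left of \<open>r\<close> and above it, hence in the region.\<close>
    have no_sw: "\<not> southwest s t" if "s \<in> T" "t \<in> T" "northwest s r" "northwest t r" for s t
    proof
      assume "southwest s t"
      then have "\<rho> (snd s) < fst t"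
        using tree_southwest[OF T] that by blast
      also have "fst t \<le> \<rho> (snd r)"
        using that tree_bounds(2)[OF T r(1)] by (auto simp: northwest_def)
      also have "\<dots> \<le> \<rho> (snd s)"
        using that by (intro row_end_mono) (auto simp: northwest_def)
      finally show False by simp
    qed
    \<comment> \<open>In the first two positions one box contains the corner of the other, so the
      corners coincide by \<open>one\<close>; the last two are excluded by
      \<open>no_sw\<close>.\<close>
    have "fst q \<le> fst p \<and> snd p \<le> snd q \<or> fst p \<le> fst q \<and> snd q \<le> snd p \<or>
        southwest p q \<or> southwest q p"
      unfolding southwest_def by linarith
    then show ?thesis
      using one[OF q nwp(2,1)] one[OF box nwq(2,1)] no_sw[OF nwp(2) nwq(2) nwp(1) nwq(1)]
        no_sw[OF nwq(2) nwp(2) nwq(1) nwp(1)]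
      by blast
  qed
  have "\<not> first_above T r s" "\<not> first_left T r s" for s
    using r(3,4) unfolding first_above_def first_left_def has_above_def has_left_def by blast+
  then have "parent \<nu> T r p"
    using box unique r(1,2) unfolding parent_def tree_root_def endpoint_nu snd_conv by blast
  then show ?thesis
    using p(1) by blast
qed

text \<open>A node of a tree never has nodes both to its left and above it. The right neighbour of a
  leftmost \<open>r\<close> and the lower neighbour of a topmost \<open>r\<close> therefore keep
  neither kind and become diagonal.\<close>

lemma node_step_remove:
  assumes "r \<in> T" "n \<in> T" "n \<noteq> r"
  shows "node_step (T - {r}) n =
    (if first_right T r n \<and> \<not> has_left T r \<or> first_below T r n \<and> \<not> has_above T r then Diag
     else node_step T n)"
proof -
  have "has_left T n" if "first_right T r n"
    using that assms by (auto simp: first_right_def has_left_def)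
  moreover have "has_above T n" if "first_below T r n"
    using that assms by (auto simp: first_below_def has_above_def)
  ultimately show ?thesis
    using not_left_and_above[OF T assms(2)]
    by (auto simp: node_step_def has_left_remove[OF assms] has_above_remove[OF assms])
qed

lemma nodes_remove:
  assumes "nodes T = A @ r # B"
  shows "nodes (T - {r}) = A @ B"
proof (rule nodes_eqI)
  have "sorted_wrt before (A @ r # B)" "set (A @ r # B) = T" "distinct (A @ r # B)"
    using sorted_nodes[OF T] set_nodes[OF T] distinct_nodes[OF T] unfolding assms by - assumption+
  then show "sorted_wrt before (A @ B)" "set (A @ B) = T - {r}"
    by (auto simp: sorted_wrt_append)
qed

section \<open>Neighbours in the reading order\<close>

text \<open>A row is read from right to left, so a node with another one to its left is followed
  immediately by its left neighbour.\<close>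

lemma adjacent_East_iff:
  assumes ns: "nodes T = A @ s # r # B"
  shows "node_step T s = East \<longleftrightarrow> first_right T r s"
proof
  have sorted: "sorted_wrt before (A @ s # r # B)"
    using sorted_nodes[OF T] unfolding ns .
  have set: "T = set (A @ s # r # B)"
    using set_nodes[OF T] unfolding ns by (rule sym)
  show "node_step T s = East" if "first_right T r s"
  proof -
    have "r \<in> T"
      unfolding set by simp
    then show ?thesis
      using that unfolding node_step_East[OF T] first_right_def has_left_def by auto
  qed
  assume "node_step T s = East"
  then obtain q where q: "q \<in> T" "snd q = snd s" "fst q < fst s"
    by (auto simp: node_step_East[OF T] has_left_def)
  have "q = r \<or> before r q"
    using q sorted unfolding set by (auto simp: sorted_wrt_append before_def)
  moreover have "before s r"
    using sorted by (simp add: sorted_wrt_append)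
  ultimately have r: "snd r = snd s" "fst r < fst s"
    using q by (auto simp: before_def)
  moreover have "fst s \<le> fst t" if "t \<in> T" "snd t = snd r" "fst r < fst t" for t
    using that sorted r unfolding set by (auto simp: sorted_wrt_append before_def)
  ultimately show "first_right T r s"
    using set by (auto simp: first_right_def)
qed

text \<open>A node read between \<open>s\<close> and \<open>r\<close> would lie in the same row
  strictly between them.\<close>

lemma first_right_adjacent:
  assumes "r \<in> T" "first_right T r s"
  obtains A B where "nodes T = A @ s # r # B"
proof -
  obtain A B where ns: "nodes T = A @ r # B"
    using assms set_nodes[OF T] by (metis split_list)
  have sorted: "sorted_wrt before (A @ r # B)"
    using sorted_nodes[OF T] unfolding ns .
  have set: "T = set (A @ r # B)"
    using set_nodes[OF T] unfolding ns by (rule sym)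
  have s: "s \<in> T" "snd s = snd r" "fst r < fst s"
    using assms by (auto simp: first_right_def)
  then have "s \<in> set A"
    using sorted unfolding set by (auto simp: sorted_wrt_append before_def)
  then obtain A' t where A: "A = A' @ [t]"
    by (metis append_butlast_last_id empty_iff empty_set)
  have "s = t"
  proof (rule ccontr)
    assume "s \<noteq> t"
    then have "before s t" "before t r"
      using \<open>s \<in> set A\<close> sorted A by (auto simp: sorted_wrt_append)
    then have "snd t = snd r" "fst r < fst t" "fst t < fst s"
      using s by (auto simp: before_def)
    then show False
      using assms(2) A set unfolding first_right_def by fastforce
  qed
  then show thesis
    using that ns A by simp
qed

text \<open>Within a column the reading order goes upwards, so the lower neighbour of
  \<open>r\<close> is the last node of the column read before \<open>r\<close>.\<close>

lemma first_below_iff: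
  assumes ns: "nodes T = A @ s # C @ r # B"
  shows "first_below T r s \<longleftrightarrow> fst r = fst s \<and> (\<forall>n\<in>set C. fst n \<noteq> fst s)"
proof -
  have sorted: "sorted_wrt before (A @ s # C @ r # B)"
    using sorted_nodes[OF T] unfolding ns .
  have set: "T = set (A @ s # C @ r # B)"
    using set_nodes[OF T] unfolding ns by (rule sym)
  have s: "s \<in> T" "before s r"
    using sorted set by (auto simp: sorted_wrt_append)
  have C: "n \<in> T" "before s n" "before n r" if "n \<in> set C" for n
    using sorted set that by (auto simp: sorted_wrt_append)
  have rest: "t = s \<or> before t s \<or> before r t" if "t \<in> T" "t \<notin> set C" "t \<noteq> r" for t
    using sorted that unfolding set by (auto simp: sorted_wrt_append)
  show ?thesis
  proof
    assume below: "first_below T r s"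
    have "fst n \<noteq> fst s" if "n \<in> set C" for n
    proof
      assume "fst n = fst s"
      then have "snd s < snd n" "snd n < snd r"
        using C[OF that] below by (auto simp: before_def first_below_def)
      then show False
        using below C(1)[OF that] \<open>fst n = fst s\<close> by (force simp: first_below_def)
    qed
    then show "fst r = fst s \<and> (\<forall>n\<in>set C. fst n \<noteq> fst s)"
      using below by (auto simp: first_below_def)
  next
    assume *: "fst r = fst s \<and> (\<forall>n\<in>set C. fst n \<noteq> fst s)"
    have "snd t \<le> snd s" if "t \<in> T" "fst t = fst r" "snd t < snd r" for t
    proof -
      have "t \<notin> set C" "t \<noteq> r"
        using that * by auto
      then show ?thesis
        using rest[of t] that * by (auto simp: before_def)
    qed
    then show "first_below T r s"
      using s * by (auto simp: first_below_def before_def)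
  qed
qed

lemma tree_path_append:
  assumes "nodes T = A @ B" "B \<noteq> []"
  shows "tree_path T = map (node_step T) A @ map (node_step T) (butlast B)"
  using assms by (simp add: tree_path_def butlast_append)

text \<open>By \<open>last_same_horiz_iff\<close> the condition on distances means that
  \<open>r\<close> is the first node after \<open>s\<close> in its column. Positions in the node
  list are the indices of the vertices.\<close>

lemma last_same_horiz_first_below:
  assumes ns: "nodes T = A @ s # C @ r # B" and "node_step T s = North"
  shows "last_same_horiz \<nu> (tree_path T) (length A) (length (A @ s # C)) \<longleftrightarrow> first_below T r s"
proof -
  let ?w = "tree_path T" and ?i = "length A" and ?j = "length (A @ s # C)"
  have len: "Suc (length ?w) = length (A @ s # C @ r # B)"
    using length_nodes[OF T] unfolding ns by simp
  have ep: "endpoint ?w = (b, a)"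
    using schroeder_path_tree_path[OF T] by (simp add: schroeder_path_iff)
  have nd: "node ?w k = (A @ s # C @ r # B) ! k" if "k \<le> ?j" for k
    using nodes_node(1)[OF T, of k] that len unfolding ns by simp
  have "?w ! ?i = North"
    using nth_tree_path[OF T, of ?i] assms(2) len unfolding ns by simp
  then have "last_same_horiz \<nu> ?w ?i ?j \<longleftrightarrow> fst (node ?w ?j) = fst (node ?w ?i) \<and>
      (\<forall>k. ?i < k \<and> k < ?j \<longrightarrow> fst (node ?w k) \<noteq> fst (node ?w ?i))"
    using len by (intro last_same_horiz_iff[OF flushable_tree_path[OF T] ep]) auto
  also have "node ?w ?j = r"
    using nd[of ?j] by (simp add: nth_append)
  also have "node ?w ?i = s"
    using nd[of ?i] by simp
  also have "(\<forall>k. ?i < k \<and> k < ?j \<longrightarrow> fst (node ?w k) \<noteq> fst s) \<longleftrightarrow> (\<forall>n\<in>set C. fst n \<noteq> fst s)"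
  proof -
    have C: "node ?w (?i + Suc k) = C ! k" if "k < length C" for k
      using nd[of "?i + Suc k"] that by (simp add: nth_append)
    have "(\<forall>k. ?i < k \<and> k < ?j \<longrightarrow> fst (node ?w k) \<noteq> fst s) \<longleftrightarrow>
        (\<forall>k<length C. fst (node ?w (?i + Suc k)) \<noteq> fst s)"
      by (auto simp: less_iff_Suc_add)
    then show ?thesis
      using C by (auto simp: all_set_conv_all_nth)
  qed
  finally show ?thesis
    using first_below_iff[OF ns] by simp
qed

end

end

section \<open>Contractions\<close>

lemma map_eq_appendE:
  assumes "map f xs = ys @ zs"
  obtains us vs where "xs = us @ vs" "map f us = ys" "map f vs = zs"
proof (rule that)
  show "xs = take (length ys) xs @ drop (length ys) xs"
    by simp
  show "map f (take (length ys) xs) = ys" "map f (drop (length ys) xs) = zs"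
    by (simp_all add: take_map[symmetric] drop_map[symmetric] assms)
qed

context nu_path
begin

text \<open>The row and the column of \<open>r\<close> must stay occupied. A surviving node of the
  row that is not to the left is to the right, and likewise in the column.\<close>

lemma removable_node:
  assumes T: "schroeder_tree \<nu> T" and r: "r \<in> T" and T': "schroeder_tree \<nu> (T - {r})"
  shows "r \<noteq> (0, a)" and "has_left T r \<or> (\<exists>s. first_right T r s)"
    and "has_above T r \<or> (\<exists>s. first_below T r s)"
proof -
  show "r \<noteq> (0, a)"
    using root_in[OF T'] by auto
  obtain p where p: "p \<in> T" "p \<noteq> r" "snd p = snd r"
    using row_nonempty[OF T' tree_bounds(1)[OF T r]] by auto
  have "fst r < fst p" if "\<not> has_left T r"
    using that p unfolding has_left_def by (metis linorder_neqE_nat prod_eqI)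
  then show "has_left T r \<or> (\<exists>s. first_right T r s)"
    using first_right_ex[OF p(1,3)] by blast
  have "fst r \<le> b"
    using tree_bounds(2)[OF T r] rho_le[of "snd r"] by simp
  then obtain q where q: "q \<in> T" "q \<noteq> r" "fst q = fst r"
    using col_nonempty[OF T'] by blast
  have "snd q < snd r" if "\<not> has_above T r"
    using that q unfolding has_above_def by (metis linorder_neqE_nat prod_eqI)
  then show "has_above T r \<or> (\<exists>s. first_below T r s)"
    using first_below_ex[OF q(1,3)] by blast
qed

text \<open>The three contractions are the three ways in which the row and the column of the removed
  node can stay occupied.\<close>

lemma tree_cover_iff:
  "(T, T') \<in> tree_cover \<nu> \<longleftrightarrow> schroeder_tree \<nu> T \<and> schroeder_tree \<nu> T' \<and> (\<exists>r\<in>T. T' = T - {r})"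
proof
  assume "(T, T') \<in> tree_cover \<nu>"
  then show "schroeder_tree \<nu> T \<and> schroeder_tree \<nu> T' \<and> (\<exists>r\<in>T. T' = T - {r})"
    unfolding tree_cover_def tree_right_contraction_def tree_left_contraction_def
      tree_diagonal_contraction_def by blast
next
  assume *: "schroeder_tree \<nu> T \<and> schroeder_tree \<nu> T' \<and> (\<exists>r\<in>T. T' = T - {r})"
  then obtain r where T: "schroeder_tree \<nu> T" and r: "r \<in> T" and T': "schroeder_tree \<nu> (T - {r})"
    and eq: "T' = T - {r}"
    by blast
  note removable = removable_node[OF T r T']
  have "tree_right_contraction T T' \<or> tree_left_contraction T T' \<or> tree_diagonal_contraction \<nu> T T'"
  proof (cases "has_left T r")
    case True
    then have "\<not> has_above T r"
      using not_left_and_above[OF T r] by blast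
    then obtain s t where "first_left T r s" "first_below T r t"
      using first_left_ex[OF True] removable(3) by blast
    then have "tree_left_contraction T T'"
      using r eq unfolding tree_left_contraction_def by blast
    then show ?thesis by blast
  next
    case noleft: False
    show ?thesis
    proof (cases "has_above T r")
      case True
      then obtain s t where "first_above T r s" "first_right T r t"
        using first_above_ex[OF True] removable(2) noleft by blast
      then have "tree_right_contraction T T'"
        using r eq unfolding tree_right_contraction_def by blast
      then show ?thesis by blast
    next
      case False
      \<comment> \<open>The parent is a non-leaf, and the other two corners of its box with
        \<open>r\<close> are empty because \<open>r\<close> has nothing to its left or above
        it.\<close>
      then obtain s where s: "northwest s r" "parent \<nu> T r s"
        using parent_Diag[OF T r removable(1) noleft] by blast
      have "s \<in> T"
        using s(2) unfolding parent_def first_above_def first_left_def isolating_box_def by blast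
      moreover have "\<not> leaf \<nu> T s"
        using s(2) unfolding leaf_def by blast
      moreover have "(fst s, snd r) \<notin> T"
        using noleft s(1) unfolding has_left_def northwest_def by force
      moreover have "(fst r, snd s) \<notin> T"
        using False s(1) unfolding has_above_def northwest_def by force
      ultimately have "tree_diagonal_contraction \<nu> T T'"
        using s(1) r T' eq unfolding tree_diagonal_contraction_def by blast
      then show ?thesis by blast
    qed
  qed
  then show "(T, T') \<in> tree_cover \<nu>"
    using T T' eq unfolding tree_cover_def by blast
qed

context
  fixes T assumes T: "schroeder_tree \<nu> T"
begin

lemma not_last_iff:
  assumes "nodes T = A @ r # B"
  shows "B \<noteq> [] \<longleftrightarrow> r \<noteq> (0, a)"
proof
  assume "B \<noteq> []"
  then have "last B = (0, a)"
    using nodes_last(2)[OF T] unfolding assms by simp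
  then show "r \<noteq> (0, a)"
    using distinct_nodes[OF T] \<open>B \<noteq> []\<close> last_in_set[of B] unfolding assms by auto
next
  show "r \<noteq> (0, a) \<Longrightarrow> B \<noteq> []"
    using nodes_last(2)[OF T] unfolding assms by auto
qed

lemma has_left_or_above_not_root:
  assumes "has_left T r \<or> has_above T r"
  shows "r \<noteq> (0, a)"
proof -
  have "snd p \<le> a" if "p \<in> T" for p
    using tree_bounds[OF T] that by blast
  then show ?thesis
    using assms by (fastforce simp: has_left_def has_above_def)
qed

lemma node_step_remove_other:
  assumes "r \<in> T" "n \<in> T" "n \<noteq> r" "has_left T r \<or> \<not> first_right T r n" "has_above T r \<or> \<not> first_below T r n"
  shows "node_step (T - {r}) n = node_step T n"
  using assms node_step_remove[OF T assms(1-3)] by auto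

section \<open>Effect of a removal on the path\<close>

text \<open>Nothing is to the left of \<open>r\<close>, so \<open>s\<close> loses its last node to
  the left and turns diagonal. A lower neighbour of \<open>r\<close> keeps its north step, since the
  nodes above \<open>r\<close> remain above it.\<close>

lemma tree_path_remove_right:
  assumes ns: "nodes T = A @ s # r # B" and s: "first_right T r s" and r: "has_above T r"
  shows "tree_path T = map (node_step T) A @ [East, North] @ map (node_step T) (butlast B)"
    and "tree_path (T - {r}) = map (node_step T) A @ [Diag] @ map (node_step T) (butlast B)"
proof -
  have set: "set (A @ s # r # B) = T" and dist: "distinct (A @ s # r # B)"
    using set_nodes[OF T] distinct_nodes[OF T] unfolding ns .
  then have "r \<in> T" "s \<in> T"
    by auto
  have B: "B \<noteq> []"
    using not_last_iff[of "A @ [s]" r B] has_left_or_above_not_root[of r] r ns by simp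
  have st: "node_step T s = East" "node_step T r = North"
    using adjacent_East_iff[OF T ns] s node_step_North[OF T \<open>r \<in> T\<close>] r by auto
  show "tree_path T = map (node_step T) A @ [East, North] @ map (node_step T) (butlast B)"
    using tree_path_append[OF T ns] B st by simp
  have T': "nodes (T - {r}) = A @ s # B"
    using nodes_remove[OF T, of "A @ [s]" r B] ns by simp
  have "node_step (T - {r}) s = Diag"
    using node_step_remove[OF T \<open>r \<in> T\<close> \<open>s \<in> T\<close>] s r dist not_left_and_above[OF T \<open>r \<in> T\<close>] by auto
  moreover have "node_step (T - {r}) n = node_step T n" if "n \<in> set A \<union> set B" for n
  proof (rule node_step_remove_other[OF \<open>r \<in> T\<close>])
    show "n \<in> T"
      using that set by auto
    show "n \<noteq> r" "has_left T r \<or> \<not> first_right T r n" "has_above T r \<or> \<not> first_below T r n"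
      using that dist r first_right_unique[OF s] by auto
  qed
  ultimately show "tree_path (T - {r}) = map (node_step T) A @ [Diag] @ map (node_step T) (butlast B)"
    unfolding tree_path_def T' using B by (auto simp: butlast_append dest: in_set_butlastD)
qed

text \<open>Here the lower neighbour \<open>s\<close> loses its last node above, while a right
  neighbour of \<open>r\<close> keeps its east step because of the nodes to the left of
  \<open>r\<close>.\<close>

lemma tree_path_remove_left:
  assumes ns: "nodes T = A @ s # C @ r # B" and s: "first_below T r s" and r: "has_left T r"
  shows "tree_path T =
      map (node_step T) A @ [North] @ map (node_step T) C @ [East] @ map (node_step T) (butlast B)"
    and "tree_path (T - {r}) =
      map (node_step T) A @ [Diag] @ map (node_step T) C @ map (node_step T) (butlast B)"
proof -
  have set: "set (A @ s # C @ r # B) = T" and dist: "distinct (A @ s # C @ r # B)"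
    using set_nodes[OF T] distinct_nodes[OF T] unfolding ns .
  then have "r \<in> T" "s \<in> T"
    by auto
  have B: "B \<noteq> []"
    using not_last_iff[of "A @ s # C" r B] has_left_or_above_not_root[of r] r ns by simp
  have "has_above T s"
    using s \<open>r \<in> T\<close> unfolding first_below_def has_above_def by auto
  then have st: "node_step T s = North" "node_step T r = East"
    using node_step_North[OF T \<open>s \<in> T\<close>] node_step_East[OF T] r by auto
  show "tree_path T =
      map (node_step T) A @ [North] @ map (node_step T) C @ [East] @ map (node_step T) (butlast B)"
    using tree_path_append[OF T, of "A @ s # C" "r # B"] ns B st by simp
  have T': "nodes (T - {r}) = A @ s # C @ B"
    using nodes_remove[OF T, of "A @ s # C" r B] ns by simp
  have "node_step (T - {r}) s = Diag"
    using node_step_remove[OF T \<open>r \<in> T\<close> \<open>s \<in> T\<close>] s r dist not_left_and_above[OF T \<open>r \<in> T\<close>] by auto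
  moreover have "node_step (T - {r}) n = node_step T n" if "n \<in> set A \<union> set B \<union> set C" for n
  proof (rule node_step_remove_other[OF \<open>r \<in> T\<close>])
    show "n \<in> T"
      using that set by auto
    show "n \<noteq> r" "has_left T r \<or> \<not> first_right T r n" "has_above T r \<or> \<not> first_below T r n"
      using that dist r first_below_unique[OF s] by auto
  qed
  ultimately show "tree_path (T - {r}) =
      map (node_step T) A @ [Diag] @ map (node_step T) C @ map (node_step T) (butlast B)"
    unfolding tree_path_def T' using B by (auto simp: butlast_append dest: in_set_butlastD)
qed

text \<open>With nothing to the left of \<open>r\<close> or above it, both neighbours
  \<open>s\<close> and \<open>q\<close> turn diagonal, and the step of \<open>r\<close> disappears.
  The condition \<open>B \<noteq> []\<close> says that \<open>r\<close> is not the root, whose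
  \<open>node_step\<close> is \<open>Diag\<close> as well.\<close>

lemma tree_path_remove_diagonal:
  assumes ns: "nodes T = A @ s # C @ q # r # B"
    and s: "first_below T r s" and q: "first_right T r q"
    and r: "node_step T r = Diag" "B \<noteq> []"
  shows "tree_path T =
      map (node_step T) A @ [North] @ map (node_step T) C @ [East, Diag] @ map (node_step T) (butlast B)"
    and "tree_path (T - {r}) =
      map (node_step T) A @ [Diag] @ map (node_step T) C @ [Diag] @ map (node_step T) (butlast B)"
proof -
  have set: "set (A @ s # C @ q # r # B) = T" and dist: "distinct (A @ s # C @ q # r # B)"
    using set_nodes[OF T] distinct_nodes[OF T] unfolding ns .
  then have in_T: "r \<in> T" "s \<in> T" "q \<in> T"
    by auto
  have r': "\<not> has_left T r" "\<not> has_above T r"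
    using r(1) by (auto simp: node_step_def split: if_splits)
  have "has_above T s"
    using s in_T unfolding first_below_def has_above_def by auto
  then have "node_step T s = North"
    using node_step_North[OF T in_T(2)] by simp
  moreover have "node_step T q = East"
    using adjacent_East_iff[OF T, of "A @ s # C" q r B] ns q by simp
  ultimately show "tree_path T =
      map (node_step T) A @ [North] @ map (node_step T) C @ [East, Diag] @ map (node_step T) (butlast B)"
    using tree_path_append[OF T, of "A @ s # C" "q # r # B"] ns r by simp
  have T': "nodes (T - {r}) = A @ s # C @ q # B"
    using nodes_remove[OF T, of "A @ s # C @ [q]" r B] ns by simp
  have "node_step (T - {r}) s = Diag" "node_step (T - {r}) q = Diag"
    using node_step_remove[OF T in_T(1,2)] node_step_remove[OF T in_T(1,3)] s q r' dist by auto
  moreover have "node_step (T - {r}) n = node_step T n" if "n \<in> set A \<union> set B \<union> set C" for n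
  proof (rule node_step_remove_other[OF in_T(1)])
    show "n \<in> T"
      using that set by auto
    show "n \<noteq> r" "has_left T r \<or> \<not> first_right T r n" "has_above T r \<or> \<not> first_below T r n"
      using that dist first_below_unique[OF s] first_right_unique[OF q] by auto
  qed
  ultimately show "tree_path (T - {r}) =
      map (node_step T) A @ [Diag] @ map (node_step T) C @ [Diag] @ map (node_step T) (butlast B)"
    unfolding tree_path_def T' using r(2) by (auto simp: butlast_append dest: in_set_butlastD)
qed

lemma first_below_split:
  assumes ns: "nodes T = A @ r # B" and s: "first_below T r s"
  obtains A1 A2 where "A = A1 @ s # A2"
proof -
  have sorted: "sorted_wrt before (A @ r # B)"
    using sorted_nodes[OF T] unfolding ns .
  have set: "set (A @ r # B) = T"
    using set_nodes[OF T] unfolding ns .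
  have "s \<in> T" "before s r"
    using s by (auto simp: first_below_def before_def)
  have "s \<in> set A \<or> s = r \<or> s \<in> set B"
    using \<open>s \<in> T\<close> unfolding set[symmetric] by auto
  moreover have "before r s" if "s \<in> set B"
    using sorted that by (auto simp: sorted_wrt_append)
  ultimately have "s \<in> set A"
    using \<open>before s r\<close> by (auto simp: before_def)
  from split_list[OF this] show thesis
    using that by blast
qed

section \<open>Covers of trees and covers of paths\<close>

text \<open>The step of the removed node \<open>r\<close> decides the kind of contraction: north
  gives a right, east a left, and diagonal a diagonal contraction.\<close>

lemma path_cover_if_tree_cover:
  assumes cover: "(T, T') \<in> tree_cover \<nu>"
  shows "(tree_path T, tree_path T') \<in> path_cover \<nu>"
proof -
  obtain r where r: "r \<in> T" and T': "schroeder_tree \<nu> (T - {r})" and eq: "T' = T - {r}"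
    using cover unfolding tree_cover_iff by blast
  note removable = removable_node[OF T r T']
  let ?w = "tree_path T" and ?w' = "tree_path (T - {r})"
  have "path_right_contraction ?w ?w' \<or> path_left_contraction \<nu> ?w ?w' \<or> path_diagonal_contraction \<nu> ?w ?w'"
  proof (cases "has_above T r")
    case True
    then have "\<not> has_left T r"
      using not_left_and_above[OF T r] by blast
    then obtain s where s: "first_right T r s"
      using removable(2) by blast
    obtain A B where ns: "nodes T = A @ s # r # B"
      using first_right_adjacent[OF T r s] .
    have "path_right_contraction ?w ?w'"
      unfolding path_right_contraction_def
      by (intro exI conjI) (rule tree_path_remove_right[OF ns s True])+
    then show ?thesis by blast
  next
    case noabove: False
    then obtain s where s: "first_below T r s"
      using removable(3) by blast
    have "has_above T s" "s \<in> T"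
      using s r unfolding first_below_def has_above_def by auto
    then have N: "node_step T s = North"
      using node_step_North[OF T] by simp
    show ?thesis
    proof (cases "has_left T r")
      case True
      have "r \<in> set (nodes T)"
        unfolding set_nodes[OF T] by (rule r)
      then obtain A' B where ns': "nodes T = A' @ r # B"
        using split_list by fast
      obtain A C where "A' = A @ s # C"
        using first_below_split[OF ns' s] .
      then have ns: "nodes T = A @ s # C @ r # B"
        using ns' by simp
      have "path_left_contraction \<nu> ?w ?w'"
        unfolding path_left_contraction_def
      proof (intro exI conjI)
        show "?w = map (node_step T) A @ [North] @ map (node_step T) C @ [East] @
            map (node_step T) (butlast B)"
          by (rule tree_path_remove_left(1)[OF ns s True])
        show "?w' = map (node_step T) A @ [Diag] @ map (node_step T) C @ map (node_step T) (butlast B)"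
          by (rule tree_path_remove_left(2)[OF ns s True])
        show "last_same_horiz \<nu> ?w (length (map (node_step T) A))
            (length (map (node_step T) A @ [North] @ map (node_step T) C))"
          using last_same_horiz_first_below[OF T ns N] s by simp
      qed
      then show ?thesis by blast
    next
      case False
      then obtain q where q: "first_right T r q"
        using removable(2) by blast
      obtain A' B where ns': "nodes T = A' @ q # r # B"
        using first_right_adjacent[OF T r q] .
      have "nodes T = (A' @ [q]) @ r # B"
        using ns' by simp
      then obtain A C' where AC: "A' @ [q] = A @ s # C'"
        using s by (rule first_below_split)
      \<comment> \<open>\<open>s\<close> is in a lower row than \<open>q\<close>, so it occurs in
        \<open>A'\<close> itself.\<close>
      have "s \<noteq> q"
        using s q by (auto simp: first_below_def first_right_def)
      then obtain C where "A' = A @ s # C"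
        using AC by (cases C' rule: rev_cases) auto
      then have ns: "nodes T = A @ s # C @ q # r # B"
        using ns' by simp
      have D: "node_step T r = Diag"
        using noabove False by (simp add: node_step_def)
      have B: "B \<noteq> []"
        using not_last_iff[of "A' @ [q]" r B] ns' removable(1) by simp
      \<comment> \<open>A diagonal contraction compares distances at the end of the east step, which
        is the vertex of \<open>r\<close>; so \<open>q\<close> is counted among the nodes between
        \<open>s\<close> and \<open>r\<close>.\<close>
      have ns'': "nodes T = A @ s # (C @ [q]) @ r # B"
        using ns by simp
      have "path_diagonal_contraction \<nu> ?w ?w'"
        unfolding path_diagonal_contraction_def
      proof (intro exI conjI)
        show "?w = map (node_step T) A @ [North] @ map (node_step T) C @ [East, Diag] @
            map (node_step T) (butlast B)"
          by (rule tree_path_remove_diagonal(1)[OF ns s q D B])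
        show "?w' = map (node_step T) A @ [Diag] @ map (node_step T) C @ [Diag] @
            map (node_step T) (butlast B)"
          by (rule tree_path_remove_diagonal(2)[OF ns s q D B])
        show "last_same_horiz \<nu> ?w (length (map (node_step T) A))
            (length (map (node_step T) A @ [North] @ map (node_step T) C @ [East]))"
          using last_same_horiz_first_below[OF T ns'' N] s by simp
      qed
      then show ?thesis by blast
    qed
  qed
  then show ?thesis
    using schroeder_path_tree_path[OF T] schroeder_path_tree_path[OF T'] eq
    unfolding path_cover_def by blast
qed

lemma tree_cover_if_removable:
  assumes "r \<in> T" "r \<noteq> (0, a)" "p \<in> T" "p \<noteq> r" "snd p = snd r" "q \<in> T" "q \<noteq> r" "fst q = fst r"
  shows "(T, T - {r}) \<in> tree_cover \<nu>"
  unfolding tree_cover_iff using schroeder_tree_remove[OF T assms(2-8)] T assms(1) by blast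

text \<open>The pattern in the word singles out the node \<open>r\<close> to remove: that of the
  north step after the east step, of the deleted east step, or of the diagonal step after the
  deleted east step, respectively. Other nodes occupy its row and its column, so the removal leaves
  a tree.\<close>

lemma tree_cover_if_path_cover:
  assumes cover: "(tree_path T, w') \<in> path_cover \<nu>"
  shows "\<exists>T'. (T, T') \<in> tree_cover \<nu> \<and> tree_path T' = w'"
proof -
  \<comment> \<open>The node list is one longer than the word; its extra last entry \<open>l\<close>
    is the root.\<close>
  have split: "\<exists>A B l. nodes T = A @ B @ [l] \<and> map (node_step T) A = u \<and> map (node_step T) B = v"
    if path: "tree_path T = u @ v" for u v
  proof -
    from path[unfolded tree_path_def] obtain A B where AB: "butlast (nodes T) = A @ B" "map (node_step T) A = u" "map (node_step T) B = v"
      by (rule map_eq_appendE)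
    have "nodes T = butlast (nodes T) @ [last (nodes T)]"
      by (rule append_butlast_last_id[OF nodes_last(1)[OF T], symmetric])
    then have "nodes T = A @ B @ [last (nodes T)]"
      unfolding AB(1) append_assoc .
    then show ?thesis
      using AB(2,3) by blast
  qed
  have in_T: "n \<in> T" if "n \<in> set (nodes T)" for n
    using that set_nodes[OF T] by blast
  consider (right) "path_right_contraction (tree_path T) w'"
    | (left) "path_left_contraction \<nu> (tree_path T) w'"
    | (diagonal) "path_diagonal_contraction \<nu> (tree_path T) w'"
    using cover unfolding path_cover_def by blast
  then show ?thesis
  proof cases
    case right
    then obtain u v where w: "tree_path T = u @ [East, North] @ v" and w': "w' = u @ [Diag] @ v"
      unfolding path_right_contraction_def by blast
    from split[OF w] obtain A B l where AB: "nodes T = A @ B @ [l]" "map (node_step T) A = u"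
      "map (node_step T) B = [East, North] @ v"
      by blast
    from AB(3) obtain s r B' where B: "B = s # r # B'" "node_step T s = East" "node_step T r = North"
      "map (node_step T) B' = v"
      by (auto simp: map_eq_Cons_conv)
    have ns: "nodes T = A @ s # r # B' @ [l]"
      using AB(1) B(1) by simp
    have "r \<in> T" "s \<in> T"
      by (auto intro!: in_T simp: ns)
    have s: "first_right T r s"
      using adjacent_East_iff[OF T ns] B(2) by simp
    have above: "has_above T r"
      using node_step_North[OF T \<open>r \<in> T\<close>] B(3) by simp
    then obtain q where "q \<in> T" "fst q = fst r" "snd r < snd q"
      by (auto simp: has_above_def)
    then have "(T, T - {r}) \<in> tree_cover \<nu>"
      using s above has_left_or_above_not_root \<open>r \<in> T\<close> \<open>s \<in> T\<close>
      by (intro tree_cover_if_removable[of r s q]) (auto simp: first_right_def)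
    moreover have "tree_path (T - {r}) = w'"
      using tree_path_remove_right(2)[OF ns s above] AB B w' by simp
    ultimately show ?thesis by blast
  next
    case left
    then obtain u v t where w: "tree_path T = u @ [North] @ v @ [East] @ t"
      and w': "w' = u @ [Diag] @ v @ t"
      and lsh: "last_same_horiz \<nu> (tree_path T) (length u) (length (u @ [North] @ v))"
      unfolding path_left_contraction_def by blast
    from split[OF w] obtain A B l where AB: "nodes T = A @ B @ [l]" "map (node_step T) A = u"
      "map (node_step T) B = [North] @ v @ [East] @ t"
      by blast
    from AB(3) obtain S E where "B = S @ E" "map (node_step T) S = [North] @ v"
      and E: "map (node_step T) E = [East] @ t"
      using map_eq_appendE[of "node_step T" B "[North] @ v" "[East] @ t"] by auto
    moreover from this(2) obtain s C where "S = s # C" "node_step T s = North" "map (node_step T) C = v"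
      by (auto simp: map_eq_Cons_conv)
    moreover from E obtain r B' where "E = r # B'" "node_step T r = East" "map (node_step T) B' = t"
      by (auto simp: map_eq_Cons_conv)
    ultimately have B: "B = s # C @ r # B'" "node_step T s = North"
      "map (node_step T) C = v" "node_step T r = East" "map (node_step T) B' = t"
      by simp_all
    have ns: "nodes T = A @ s # C @ r # B' @ [l]"
      using AB(1) B(1) by simp
    have "r \<in> T" "s \<in> T"
      by (auto intro!: in_T simp: ns)
    have s: "first_below T r s"
      using last_same_horiz_first_below[OF T ns B(2)] lsh AB(2) B(3) by auto
    have left: "has_left T r"
      using node_step_East[OF T] B(4) by simp
    then obtain p where "p \<in> T" "snd p = snd r" "fst p < fst r"
      by (auto simp: has_left_def)
    then have "(T, T - {r}) \<in> tree_cover \<nu>"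
      using s left has_left_or_above_not_root \<open>r \<in> T\<close> \<open>s \<in> T\<close>
      by (intro tree_cover_if_removable[of r p s]) (auto simp: first_below_def)
    moreover have "tree_path (T - {r}) = w'"
      using tree_path_remove_left(2)[OF ns s left] AB B w' by simp
    ultimately show ?thesis by blast
  next
    case diagonal
    then obtain u v t where w: "tree_path T = u @ [North] @ v @ [East, Diag] @ t"
      and w': "w' = u @ [Diag] @ v @ [Diag] @ t"
      and lsh: "last_same_horiz \<nu> (tree_path T) (length u) (length (u @ [North] @ v @ [East]))"
      unfolding path_diagonal_contraction_def by blast
    from split[OF w] obtain A B l where AB: "nodes T = A @ B @ [l]" "map (node_step T) A = u"
      "map (node_step T) B = [North] @ v @ [East, Diag] @ t"
      by blast
    from AB(3) obtain S E where "B = S @ E" "map (node_step T) S = [North] @ v"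
      and E: "map (node_step T) E = [East, Diag] @ t"
      using map_eq_appendE[of "node_step T" B "[North] @ v" "[East, Diag] @ t"] by auto
    moreover from this(2) obtain s C where "S = s # C" "node_step T s = North" "map (node_step T) C = v"
      by (auto simp: map_eq_Cons_conv)
    moreover from E obtain q r B' where "E = q # r # B'" "node_step T q = East" "node_step T r = Diag"
      "map (node_step T) B' = t"
      by (auto simp: map_eq_Cons_conv)
    ultimately have B: "B = s # C @ q # r # B'" "node_step T s = North"
      "map (node_step T) C = v" "node_step T q = East" "node_step T r = Diag" "map (node_step T) B' = t"
      by simp_all
    have ns: "nodes T = A @ s # C @ q # r # B' @ [l]"
      using AB(1) B(1) by simp
    have "r \<in> T" "s \<in> T" "q \<in> T"
      by (auto intro!: in_T simp: ns)
    have "nodes T = A @ s # (C @ [q]) @ r # B' @ [l]"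
      using ns by simp
    from last_same_horiz_first_below[OF T this B(2)] have s: "first_below T r s"
      using lsh AB(2) B(3) by auto
    have "nodes T = (A @ s # C) @ q # r # B' @ [l]"
      using ns by simp
    from adjacent_East_iff[OF T this] have q: "first_right T r q"
      using B(4) by simp
    \<comment> \<open>A diagonal \<open>node_step\<close> alone does not exclude the root; that
      another node follows \<open>r\<close> does.\<close>
    have "nodes T = (A @ s # C @ [q]) @ r # B' @ [l]"
      using ns by simp
    from not_last_iff[OF this] have "r \<noteq> (0, a)"
      by simp
    then have "(T, T - {r}) \<in> tree_cover \<nu>"
      using s q \<open>r \<in> T\<close> \<open>s \<in> T\<close> \<open>q \<in> T\<close>
      by (intro tree_cover_if_removable[of r q s]) (auto simp: first_below_def first_right_def)
    moreover have "tree_path (T - {r}) = w'"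
      using tree_path_remove_diagonal(2)[OF ns s q B(5)] AB B w' by simp
    ultimately show ?thesis by blast
  qed
qed

end

section \<open>Comparison of the two orders\<close>

text \<open>Covers translate one at a time. A chain of path covers starting at
  \<open>tree_path S\<close> lifts to a chain of trees starting at \<open>S\<close>, whose end is
  \<open>T\<close> because \<open>path_tree\<close> inverts \<open>tree_path\<close>.\<close>

lemma tree_order_iff:
  assumes S: "schroeder_tree \<nu> S" and T: "schroeder_tree \<nu> T"
  shows "(S, T) \<in> tree_order \<nu> \<longleftrightarrow> (tree_path S, tree_path T) \<in> path_order \<nu>"
proof -
  have "(tree_path S, tree_path T) \<in> (path_cover \<nu>)\<^sup>*" if "(S, T) \<in> (tree_cover \<nu>)\<^sup>*"
    using that
  proof (induction rule: rtrancl_induct)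
    case (step T T')
    then have "schroeder_tree \<nu> T"
      unfolding tree_cover_iff by blast
    from path_cover_if_tree_cover[OF this step(2)] show ?case
      by (rule rtrancl_into_rtrancl[OF step.IH])
  qed simp
  moreover have "(S, T) \<in> (tree_cover \<nu>)\<^sup>*" if "(tree_path S, tree_path T) \<in> (path_cover \<nu>)\<^sup>*"
  proof -
    have "\<exists>T'. schroeder_tree \<nu> T' \<and> (S, T') \<in> (tree_cover \<nu>)\<^sup>* \<and> tree_path T' = w"
      if "(tree_path S, w) \<in> (path_cover \<nu>)\<^sup>*" for w
      using that
    proof (induction rule: rtrancl_induct)
      case (step w w')
      then obtain T' where T': "schroeder_tree \<nu> T'" "(S, T') \<in> (tree_cover \<nu>)\<^sup>*" "tree_path T' = w"
        by blast
      then obtain T'' where T'': "(T', T'') \<in> tree_cover \<nu>" "tree_path T'' = w'"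
        using step(2) tree_cover_if_path_cover[OF T'(1), of w'] by blast
      then have "schroeder_tree \<nu> T''"
        unfolding tree_cover_iff by blast
      then show ?case
        using rtrancl_into_rtrancl[OF T'(2) T''(1)] T''(2) by blast
    qed (use S in blast)
    from this[OF that] obtain T' where "schroeder_tree \<nu> T'" "(S, T') \<in> (tree_cover \<nu>)\<^sup>*"
      "tree_path T' = tree_path T"
      by blast
    moreover from this have "T' = T"
      using path_tree_tree_path T by metis
    ultimately show ?thesis by simp
  qed
  ultimately show ?thesis
    using S T schroeder_path_tree_path
    by (auto simp: tree_order_def path_order_def schroeder_trees_def schroeder_paths_def)
qed

end

theorem theorem3p13:
  fixes \<nu> :: "step list" and a b :: nat
  assumes "lattice_path a b \<nu>"
  shows "\<exists>\<phi>. bij_betw \<phi> (schroeder_trees \<nu>) (schroeder_paths \<nu>) \<and>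
             (\<forall>S \<in> schroeder_trees \<nu>. \<forall>T \<in> schroeder_trees \<nu>.
                (S, T) \<in> tree_order \<nu> \<longleftrightarrow> (\<phi> S, \<phi> T) \<in> path_order \<nu>)"
proof -
  interpret nu_path a b \<nu>
    by standard (rule assms)
  show ?thesis
    using bij_betw_tree_path tree_order_iff by (auto simp: schroeder_trees_def)
qed

end
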